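(* Let $a,b,c$ be arbitrary real numbers, and let $Q(x,y)\equiv Q(t;x,y;a,b,c)$ be the weighted generating function of reverse Kreweras walks in the quarter plane, i.e. walks starting at $(0,0)$, staying in $\{(k,l)\in\mathbb{Z}^2 : k,l\ge 0\}$, with steps in $\{(-1,-1),(0,1),(1,0)\}$, with weight $a$ for each visit to the $x$-axis away from the origin, weight $b$ for each visit to the $y$-axis away from the origin, and weight $c$ for each visit to the origin. Then $Q(x,y)$ is algebraic; that is, $Q(t;x,y;a,b,c)$, as a formal power series in $t$ with coefficients polynomial in $x,y$, is algebraic over the field $\mathbb{C}(t,x,y)$.
   Context: Generating function. For a step set $\mathcal{S}\subseteq\{-1,0,1\}^2$, let $q_{n,k,l,h,v,u}$ be the number of walks of $n$ steps, each step in $\mathcal{S}$, starting at $(0,0)$, ending at $(k,l)$, with all vertices in $\{(i,j)\in\mathbb{Z}^2: i,j\geq 0\}$, which visit the horizontal boundary (points $(i,0)$ with $i>0$) exactly $h$ times, the vertical boundary (points $(0,j)$ with $j>0$) exactly $v$ times, and the origin $(0,0)$ exactly $u$ times. The starting vertex is not counted as a visit to the origin, so the empty walk has weight $1$. Define $$Q(x,y)\equiv Q(t;x,y;a,b,c)=\sum_{n\ge 0}t^n\sum_{k,l,h,v,u}q_{n,k,l,h,v,u}\,x^k y^l a^h b^v c^u .$$ This is a formal power series in $t$ whose coefficients are polynomials in $x,y$. For reverse Kreweras walks $\mathcal{S}=\{(-1,-1),(0,1),(1,0)\}$. *)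

theory Defs
  imports
    Complex_Main
    "HOL-Library.Product_Plus"
    "HOL-Computational_Algebra.Computational_Algebra"
    "HOL-Algebra.Algebraic_Closure_Type"
begin

section \<open>Walks in the quarter plane\<close>

text \<open>A walk is given by its list of steps; \<open>vertex w i\<close> is its position after \<open>i\<close> steps.\<close>

definition vertex :: "(int \<times> int) list \<Rightarrow> nat \<Rightarrow> int \<times> int"
  where "vertex w i = sum_list (take i w)"

definition quarter_walks :: "(int \<times> int) set \<Rightarrow> nat \<Rightarrow> (int \<times> int) list set"
  where "quarter_walks S n =
    {w. length w = n \<and> set w \<subseteq> S \<and> (\<forall>i\<le>n. 0 \<le> fst (vertex w i) \<and> 0 \<le> snd (vertex w i))}"

definition horizontal_visits :: "(int \<times> int) list \<Rightarrow> nat"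
  where "horizontal_visits w =
    card {i. i \<le> length w \<and> 0 < fst (vertex w i) \<and> snd (vertex w i) = 0}"

definition vertical_visits :: "(int \<times> int) list \<Rightarrow> nat"
  where "vertical_visits w =
    card {i. i \<le> length w \<and> fst (vertex w i) = 0 \<and> 0 < snd (vertex w i)}"

text \<open>The starting vertex \<open>i = 0\<close> does not count as a visit to the origin.\<close>

definition origin_visits :: "(int \<times> int) list \<Rightarrow> nat"
  where "origin_visits w = card {i. 1 \<le> i \<and> i \<le> length w \<and> vertex w i = (0, 0)}"

definition walk_count ::
    "(int \<times> int) set \<Rightarrow> nat \<Rightarrow> nat \<Rightarrow> nat \<Rightarrow> nat \<Rightarrow> nat \<Rightarrow> nat \<Rightarrow> nat"
  where "walk_count S n k l h v u =
    card {w \<in> quarter_walks S n. vertex w n = (int k, int l) \<and>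
      horizontal_visits w = h \<and> vertical_visits w = v \<and> origin_visits w = u}"


section \<open>The generating function\<close>

text \<open>
  A polynomial ring in \<open>x\<close> and \<open>y\<close> is modelled as \<open>'a poly poly\<close>, with \<open>x\<close> the inner and \<open>y\<close>
  the outer variable, so that \<open>monom (monom r k) l\<close> is \<open>r x^k y^l\<close>.  The sum over
  \<open>k, l, h, v, u\<close> may be cut off at \<open>n\<close>: for small steps all other terms vanish, as shown in
  \<open>walk_count_nonzero_imp_le\<close> below.
\<close>

definition walk_gf ::
    "(int \<times> int) set \<Rightarrow> 'a \<Rightarrow> 'a \<Rightarrow> 'a \<Rightarrow> 'a::comm_semiring_1 poly poly fps"
  where "walk_gf S a b c = Abs_fps (\<lambda>n.
    \<Sum>k\<le>n. \<Sum>l\<le>n. \<Sum>h\<le>n. \<Sum>v\<le>n. \<Sum>u\<le>n.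
      Polynomial.monom
        (Polynomial.monom (of_nat (walk_count S n k l h v u) * a ^ h * b ^ v * c ^ u) k) l)"

definition reverse_kreweras :: "(int \<times> int) set"
  where "reverse_kreweras = {(-1, -1), (0, 1), (1, 0)}"

lemma vertex_bound:
  assumes "set w \<subseteq> {-1, 0, 1} \<times> {-1, 0, 1}"
  shows "fst (vertex w i) \<le> int (length w) \<and> snd (vertex w i) \<le> int (length w)"
proof -
  have *: "fst (sum_list xs) \<le> int (length xs) \<and> snd (sum_list xs) \<le> int (length xs)"
    if "set xs \<subseteq> {-1, 0, 1} \<times> {-1, 0, 1}" for xs :: "(int \<times> int) list"
    using that by (induction xs) auto
  have "set (take i w) \<subseteq> {-1, 0, 1} \<times> {-1, 0, 1}"
    using assms set_take_subset by fast
  from *[OF this] show ?thesis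
    by (auto simp: vertex_def)
qed

lemma card_visits_le:
  assumes "\<And>i. P i \<Longrightarrow> 1 \<le> i \<and> i \<le> n"
  shows "card {i. P i} \<le> n"
proof -
  have "card {i. P i} \<le> card {1..n}"
    by (rule card_mono) (use assms in auto)
  thus ?thesis by simp
qed

lemma walk_count_nonzero_imp_le:
  assumes S: "S \<subseteq> {-1, 0, 1} \<times> {-1, 0, 1}" and nz: "walk_count S n k l h v u \<noteq> 0"
  shows "k \<le> n" "l \<le> n" "h \<le> n" "v \<le> n" "u \<le> n"
proof -
  have "{w \<in> quarter_walks S n. vertex w n = (int k, int l) \<and>
      horizontal_visits w = h \<and> vertical_visits w = v \<and> origin_visits w = u} \<noteq> {}"
    using nz unfolding walk_count_def by (metis card.empty)
  then obtain w where w: "length w = n" "set w \<subseteq> S" "vertex w n = (int k, int l)"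
      "horizontal_visits w = h" "vertical_visits w = v" "origin_visits w = u"
    by (auto simp: quarter_walks_def)
  show "k \<le> n" "l \<le> n"
    using vertex_bound[of w n] w S by auto
  have pos: "1 \<le> i" if "vertex w i \<noteq> (0, 0)" for i
    using that by (cases i) (auto simp: vertex_def zero_prod_def)
  show "h \<le> n"
    unfolding w(4)[symmetric] horizontal_visits_def
    by (rule card_visits_le) (use pos w(1) in force)
  show "v \<le> n"
    unfolding w(5)[symmetric] vertical_visits_def
    by (rule card_visits_le) (use pos w(1) in force)
  show "u \<le> n"
    unfolding w(6)[symmetric] origin_visits_def
    by (rule card_visits_le) (use w(1) in auto)
qed


section \<open>Rational functions inside the fraction field of the power series\<close>

text \<open>
  \<open>\<complex>(t, x, y)\<close> as a subfield of the field of fractions of \<open>\<complex>[x, y][[t]]\<close>: the quotients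
  \<open>p / q\<close> with \<open>p, q \<in> \<complex>[x, y][t]\<close> and \<open>q \<noteq> 0\<close>.  Here \<open>t\<close> is the outermost polynomial variable,
  and \<open>fps_of_poly\<close> is the inclusion of \<open>\<complex>[x, y][t]\<close> into \<open>\<complex>[x, y][[t]]\<close>.
\<close>

definition rational_functions :: "complex poly poly fps fract set"
  where "rational_functions =
    {to_fract (fps_of_poly p) / to_fract (fps_of_poly q) | p q. q \<noteq> 0}"

lemma subfield_rational_functions:
  "subfield rational_functions (ring_of_type_algebra :: complex poly poly fps fract ring)"
proof -
  let ?R = "ring_of_type_algebra :: complex poly poly fps fract ring"
  let ?e = "\<lambda>p :: complex poly poly poly. to_fract (fps_of_poly p)"
  interpret R: field ?R by rule
  have car: "carrier ?R = UNIV" and one: "\<one>\<^bsub>?R\<^esub> = 1" and zero: "\<zero>\<^bsub>?R\<^esub> = 0"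
    and mult: "\<And>x y. x \<otimes>\<^bsub>?R\<^esub> y = x * y" and add: "\<And>x y. x \<oplus>\<^bsub>?R\<^esub> y = x + y"
    by (simp_all add: ring_of_type_algebra_def)
  have ainv: "\<ominus>\<^bsub>?R\<^esub> x = - x" for x
    using R.minus_equality[of "- x" x] by (simp add: car zero add)
  have minv: "inv\<^bsub>?R\<^esub> x = inverse x" if "x \<noteq> 0" for x
    using R.inv_unique'[of x "inverse x"] that by (simp add: car one mult)
  have nz: "?e q \<noteq> 0" if "q \<noteq> 0" for q
    using that fps_of_poly_eq_iff[of q 0] by simp
  have memI: "?e p / ?e q \<in> rational_functions" if "q \<noteq> 0" for p q
    using that unfolding rational_functions_def by blast
  show ?thesis
  proof (rule R.subfieldI'[OF R.subringI])
    show "rational_functions \<subseteq> carrier ?R" by (simp add: car)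
    show "\<one>\<^bsub>?R\<^esub> \<in> rational_functions"
      using memI[of 1 1] by (simp add: one)
  next
    fix f assume "f \<in> rational_functions"
    then obtain p q where f: "f = ?e p / ?e q" "q \<noteq> 0"
      unfolding rational_functions_def by blast
    have "- f = ?e (- p) / ?e q"
      by (simp add: f fps_of_poly_uminus)
    with f(2) show "\<ominus>\<^bsub>?R\<^esub> f \<in> rational_functions"
      using memI by (simp only: ainv)
  next
    fix f g assume "f \<in> rational_functions" "g \<in> rational_functions"
    then obtain p q r s where f: "f = ?e p / ?e q" "q \<noteq> 0" and g: "g = ?e r / ?e s" "s \<noteq> 0"
      unfolding rational_functions_def by blast
    have "f * g = ?e (p * r) / ?e (q * s)"
      by (simp add: f g fps_of_poly_mult)
    thus "f \<otimes>\<^bsub>?R\<^esub> g \<in> rational_functions"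
      using f(2) g(2) memI[of "q * s" "p * r"] by (simp only: mult) simp
    have "f + g = ?e (p * s + r * q) / ?e (q * s)"
      using nz[OF f(2)] nz[OF g(2)]
      by (simp add: f g fps_of_poly_mult fps_of_poly_add add_frac_eq)
    thus "f \<oplus>\<^bsub>?R\<^esub> g \<in> rational_functions"
      using f(2) g(2) memI[of "q * s" "p * s + r * q"] by (simp only: add) simp
  next
    fix f assume "f \<in> rational_functions - {\<zero>\<^bsub>?R\<^esub>}"
    then obtain p q where f: "f = ?e p / ?e q" "q \<noteq> 0" "f \<noteq> 0"
      unfolding rational_functions_def zero by blast
    have "p \<noteq> 0" using f by auto
    moreover have "inverse f = ?e q / ?e p" by (simp add: f)
    ultimately show "inv\<^bsub>?R\<^esub> f \<in> rational_functions"
      using memI minv[OF f(3)] by simp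
  qed
qed

lemma algebraic_over_type_algebraI:
  fixes p :: "'a::field poly" and x :: 'a
  assumes K: "\<And>i. poly.coeff p i \<in> K" and nz: "p \<noteq> 0" and root: "poly p x = 0"
  shows "(ring.algebraic (ring_of_type_algebra :: 'a ring) over K) x"
proof -
  let ?R = "ring_of_type_algebra :: 'a ring"
  interpret R: field ?R by rule
  have zero: "\<zero>\<^bsub>?R\<^esub> = 0" and mult: "\<And>x y. x \<otimes>\<^bsub>?R\<^esub> y = x * y"
    and add: "\<And>x y. x \<oplus>\<^bsub>?R\<^esub> y = x + y" and one: "\<one>\<^bsub>?R\<^esub> = 1"
    by (simp_all add: ring_of_type_algebra_def)
  have pow: "y [^]\<^bsub>?R\<^esub> n = y ^ n" for y and n :: nat
    by (induction n) (simp_all add: one mult)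
  have eval: "R.eval (rev xs) x = poly (Poly xs) x" for xs
    by (induction xs rule: rev_induct)
      (simp_all add: zero mult add pow Poly_snoc poly_monom)
  show ?thesis
  proof (rule R.algebraicI)
    have "coeffs p \<noteq> []" using nz by simp
    moreover have "set (coeffs p) \<subseteq> K" using K by (auto simp: coeffs_def)
    moreover have "last (coeffs p) \<noteq> 0" using nz by (simp add: last_coeffs_eq_coeff_degree)
    ultimately show "rev (coeffs p) \<in> carrier (K [X]\<^bsub>?R\<^esub>)"
      by (simp add: univ_poly_def polynomial_def zero hd_rev)
    show "rev (coeffs p) \<noteq> []" using nz by simp
    show "R.eval (rev (coeffs p)) x = \<zero>\<^bsub>?R\<^esub>"
      using eval[of "coeffs p"] root by (simp add: zero)
  qed
qed

end

theory Submission
  imports Defs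
begin

text \<open>
  This is Tutte's invariant method.  On the kernel curve \<open>1 = t (x + y + z)\<close>, \<open>x y z = 1\<close> the
  function \<open>I(x) = t x^2 - x - t / x\<close> satisfies \<open>I(x) = I(y) = I(z)\<close>.  Up to normalisation the
  functional equation of \<open>Q\<close> restricted to the curve reads
  \<open>\<lambda>\<^sub>a(z) A(x) + \<lambda>\<^sub>b(z) B(y) + \<mu> - t z \<nu> = 0\<close> with \<open>\<lambda>\<^sub>a(z) = (a - 1) - a t z\<close> and with \<open>\<mu>\<close>, \<open>\<nu>\<close>
  affine in the series of returns to the origin.  Since \<open>\<lambda>\<^sub>a(x) \<lambda>\<^sub>a(y) \<lambda>\<^sub>a(z)\<close> is a polynomial in \<open>I\<close>,
  multiplication by \<open>\<lambda>\<^sub>a(y) \<lambda>\<^sub>b(x)\<close> separates \<open>x\<close> from \<open>y\<close> for all weights.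

  An explicit algebraic function \<open>D\<close>, a square root of \<open>(I - i\<^sub>1) (I - i\<^sub>2)\<close> for two critical values
  \<open>i\<^sub>1, i\<^sub>2\<close> of \<open>I\<close>, satisfies \<open>D(x) + D(y) = 0\<close> on the curve.  Subtracting multiples of \<open>I\<close> and \<open>D\<close>
  removes the poles at \<open>x = 0\<close> and \<open>y = 0\<close>, and a pole-free function of \<open>x\<close> that equals a pole-free
  function of \<open>y\<close> modulo the kernel is a constant \<open>q\<close>.  Evaluating the two resulting identities at
  small roots of the norm of \<open>\<lambda>\<^sub>a\<close> and \<open>\<lambda>\<^sub>b\<close> (or at \<open>0\<close> when a weight is \<open>1\<close>) gives nondegenerate
  linear equations with algebraic coefficients for \<open>q\<close> and for the series of returns to the origin.
\<close>

section \<open>Formal power series\<close>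

text \<open>The \<open>X\<close>-adically continuous extension of \<open>\<phi>\<close> that fixes
  the variable. Values of \<open>\<phi>\<close> may involve the variable themselves, so coefficient
  \<open>n\<close> collects contributions from all \<open>i \<le> n\<close>.\<close>

definition fps_hom_ext :: "('a::comm_ring_1 \<Rightarrow> 'b::comm_ring_1 fps) \<Rightarrow> 'a fps \<Rightarrow> 'b fps"
  where "fps_hom_ext \<phi> F = Abs_fps (\<lambda>n. \<Sum>i\<le>n. \<phi> (F $ i) $ (n - i))"

lemma fps_cons_decomp: "F = fps_const (F $ 0) + fps_X * fps_shift 1 (F :: 'a::comm_ring_1 fps)"
  by (rule fps_ext, simp add: fps_X_mult_nth)

locale hom_into_fps =
  fixes \<phi> :: "'a::comm_ring_1 \<Rightarrow> 'b::comm_ring_1 fps"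
  assumes hom_1: "\<phi> 1 = 1"
    and hom_add: "\<phi> (p + q) = \<phi> p + \<phi> q"
    and hom_mult: "\<phi> (p * q) = \<phi> p * \<phi> q"
begin

lemma hom_0: "\<phi> 0 = 0"
  using hom_add[of 0 0] by simp

abbreviation "ext \<equiv> fps_hom_ext \<phi>"

lemma ext_cons: "ext (fps_const r + fps_X * F) = \<phi> r + fps_X * ext F"
proof (rule fps_ext)
  fix n show "ext (fps_const r + fps_X * F) $ n = (\<phi> r + fps_X * ext F) $ n"
    by (cases n) (simp_all add: fps_hom_ext_def sum.atMost_Suc_shift fps_X_mult_nth del: sum.atMost_Suc)
qed

lemma ext_add: "ext (F + H) = ext F + ext H"
  by (rule fps_ext) (simp add: fps_hom_ext_def hom_add sum.distrib)

lemma ext_0: "ext 0 = 0"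
  using ext_add[of 0 0] by simp

lemma ext_const: "ext (fps_const r) = \<phi> r"
  using ext_cons[of r 0] by (simp add: ext_0)

lemma ext_X: "ext fps_X = fps_X"
  using ext_cons[of 0 1] ext_const[of 1] by (simp add: hom_0 hom_1)

lemma ext_1: "ext 1 = 1"
  using ext_const[of 1] by (simp add: hom_1)

lemma ext_mult: "ext (F * H) = ext F * ext H"
proof -
  \<comment> \<open>Splitting off both constant terms turns the defect of multiplicativity into the
    variable times a sum of two such defects, so each coefficient reduces to the preceding
    one.\<close>
  have "(ext (F * H) - ext F * ext H) $ n = 0" for n
  proof (induction n arbitrary: F H rule: less_induct)
    case (less n)
    define r F' where "r = F $ 0" and "F' = fps_shift 1 F"
    define s H' where "s = H $ 0" and "H' = fps_shift 1 H"
    have F: "F = fps_const r + fps_X * F'" and H: "H = fps_const s + fps_X * H'"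
      unfolding r_def F'_def s_def H'_def by (rule fps_cons_decomp)+
    have FH: "F * H = fps_const (r * s) + fps_X * (fps_const r * H' + F' * H)"
      by (simp add: F H algebra_simps)
    have "ext (F * H) - ext F * ext H = fps_X * ((ext (fps_const r * H') - \<phi> r * ext H')
        + (ext (F' * H) - ext F' * ext H))"
    proof -
      have "ext F * ext H = \<phi> r * (\<phi> s + fps_X * ext H') + fps_X * (ext F' * ext H)"
        by (metis F H ext_cons distrib_right mult.assoc)
      moreover have "ext (F * H) = \<phi> r * \<phi> s + fps_X * (ext (fps_const r * H') + ext (F' * H))"
        unfolding FH ext_cons by (simp only: ext_add hom_mult)
      ultimately show ?thesis by (simp only: algebra_simps)
    qed
    thus ?case
      using less[of _ "fps_const r" H'] less[of _ F' H]
      by (cases n) (simp_all add: ext_const fps_X_mult_nth del: fps_mult_left_const_nth fps_mult_fps_X_commute)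
  qed
  thus ?thesis by (metis eq_iff_diff_eq_0 fps_ext fps_zero_nth)
qed

lemma ext_uminus: "ext (- F) = - ext F"
  using ext_add[of F "- F"] by (simp add: ext_0 eq_neg_iff_add_eq_0 add.commute)

lemma ext_diff: "ext (F - H) = ext F - ext H"
  using ext_add[of F "- H"] by (simp add: ext_uminus)

lemma ext_power: "ext (F ^ n) = ext F ^ n"
  by (induction n) (simp_all add: ext_1 ext_mult)

end

section \<open>Fixed points and units of power series\<close>

text \<open>Contraction principle: coefficient \<open>n\<close> of the iterates of
  \<open>\<Phi>\<close> from \<open>0\<close> no longer changes from iterate \<open>n + 1\<close>
  on.\<close>

lemma fps_fixed_point:
  fixes \<Phi> :: "'a::zero fps \<Rightarrow> 'a fps"
  assumes "\<And>f g n. (\<And>i. i < n \<Longrightarrow> f $ i = g $ i) \<Longrightarrow> \<Phi> f $ n = \<Phi> g $ n"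
  obtains f where "f = \<Phi> f"
proof -
  define h where "h n = (\<Phi> ^^ n) 0" for n
  have step: "h (Suc n) = \<Phi> (h n)" for n by (simp add: h_def)
  have stable: "h (Suc m) $ n = h (Suc n) $ n" if "n \<le> m" for m n
    using that
  proof (induction n arbitrary: m rule: less_induct)
    case (less n)
    have "h m $ i = h n $ i" if "i < n" for i
      using less.IH[of i "m - 1"] less.IH[of i "n - 1"] that less.prems by simp
    thus ?case unfolding step by (rule assms)
  qed
  define f where "f = Abs_fps (\<lambda>n. h (Suc n) $ n)"
  have "f = \<Phi> f"
  proof (rule fps_ext)
    fix n
    have "h n $ i = f $ i" if "i < n" for i
      using stable[of i "n - 1"] that by (simp add: f_def)
    from assms[OF this] show "f $ n = \<Phi> f $ n" by (simp add: f_def step)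
  qed
  thus thesis by (rule that)
qed

lemma fps_X_dvdI: "F $ 0 = 0 \<Longrightarrow> \<exists>H. F = fps_X * (H :: 'a::comm_ring_1 fps)"
  using fps_cons_decomp[of F] by auto

lemma fps_unitI:
  assumes "F $ 0 * r = (1 :: 'a::comm_ring_1)"
  obtains H where "F * H = 1"
  using fps_right_inverse[OF assms] by blast

section \<open>Algebraic power series\<close>

abbreviation (input) type_ring :: "complex poly poly fps fract ring"
  where "type_ring \<equiv> ring_of_type_algebra"

definition algebraic_fract :: "complex poly poly fps fract \<Rightarrow> bool"
  where "algebraic_fract = (ring.algebraic type_ring over rational_functions)"

definition algebraic_fps :: "complex poly poly fps \<Rightarrow> bool"
  where "algebraic_fps F = algebraic_fract (to_fract F)"

section \<open>Closure properties of algebraic elements\<close>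

lemma algebraic_fract_rational: "z \<in> rational_functions \<Longrightarrow> algebraic_fract z"
proof -
  assume z: "z \<in> rational_functions"
  interpret R: field type_ring by rule
  show ?thesis unfolding algebraic_fract_def
    using R.algebraic_self[OF subfieldE(1)[OF subfield_rational_functions] z] .
qed

text \<open>The elements algebraic over a subfield form a subfield; the rest translates ring
  operations into type class operations.\<close>

lemma
  shows algebraic_fract_add: "algebraic_fract x \<Longrightarrow> algebraic_fract y \<Longrightarrow> algebraic_fract (x + y)"
    and algebraic_fract_mult: "algebraic_fract x \<Longrightarrow> algebraic_fract y \<Longrightarrow> algebraic_fract (x * y)"
    and algebraic_fract_inverse: "algebraic_fract x \<Longrightarrow> algebraic_fract (inverse x)"
proof -
  let ?A = "{x \<in> carrier type_ring. (ring.algebraic type_ring over rational_functions) x}"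
  interpret R: field type_ring by rule
  have car: "carrier type_ring = UNIV" and one: "\<one>\<^bsub>type_ring\<^esub> = 1" and zero: "\<zero>\<^bsub>type_ring\<^esub> = 0"
    and mult: "\<And>x y. x \<otimes>\<^bsub>type_ring\<^esub> y = x * y" and add: "\<And>x y. x \<oplus>\<^bsub>type_ring\<^esub> y = x + y"
    by (simp_all add: ring_of_type_algebra_def)
  have A: "subfield ?A type_ring"
    by (rule R.subfield_of_algebraics[OF subfield_rational_functions])
  have mem: "x \<in> ?A \<longleftrightarrow> algebraic_fract x" for x
    by (simp add: car algebraic_fract_def)
  note sub = subringE[OF subfieldE(1)[OF A]]
  show "algebraic_fract x \<Longrightarrow> algebraic_fract y \<Longrightarrow> algebraic_fract (x + y)"
    using sub(7)[of x y] unfolding mem add .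
  show "algebraic_fract x \<Longrightarrow> algebraic_fract y \<Longrightarrow> algebraic_fract (x * y)"
    using sub(6)[of x y] unfolding mem mult .
  have minv: "inv\<^bsub>type_ring\<^esub> x = inverse x" if "x \<noteq> 0" for x
    using R.inv_unique'[of x "inverse x"] that by (simp add: car one mult)
  show "algebraic_fract x \<Longrightarrow> algebraic_fract (inverse x)"
  proof (cases "x = 0")
    case False
    assume "algebraic_fract x"
    hence "x \<in> ?A - {\<zero>\<^bsub>type_ring\<^esub>}" unfolding zero using mem False by blast
    from R.subfield_m_inv(1)[OF A this] show ?thesis unfolding minv[OF False] using mem by blast
  qed simp
qed

lemma fps_of_poly_rational: "to_fract (fps_of_poly p) \<in> rational_functions"
proof -
  have "to_fract (fps_of_poly p) = to_fract (fps_of_poly p) / to_fract (fps_of_poly 1)"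
    by simp
  thus ?thesis unfolding rational_functions_def using one_neq_zero by blast
qed

lemma zero_rational: "0 \<in> rational_functions"
  using fps_of_poly_rational[of 0] by simp

lemma algebraic_fps_poly: "algebraic_fps (fps_of_poly p)"
  unfolding algebraic_fps_def
  by (rule algebraic_fract_rational) (rule fps_of_poly_rational)

lemma algebraic_fps_const [intro]: "algebraic_fps (fps_const p)"
  using algebraic_fps_poly[of "[:p:]"] by (simp add: fps_of_poly_const)

lemma algebraic_fps_X [intro]: "algebraic_fps fps_X"
  using algebraic_fps_poly[of "[:0, 1:]"] by (simp add: fps_of_poly_pCons)

lemma algebraic_fps_numeral [intro]: "algebraic_fps 0" "algebraic_fps 1" "algebraic_fps (numeral k)"
  using algebraic_fps_const[of 0] algebraic_fps_const[of 1] algebraic_fps_const[of "numeral k"]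
  by (simp_all add: numeral_fps_const)

lemma algebraic_fps_add [intro]: "algebraic_fps F \<Longrightarrow> algebraic_fps H \<Longrightarrow> algebraic_fps (F + H)"
  by (simp add: algebraic_fps_def algebraic_fract_add)

lemma algebraic_fps_mult [intro]: "algebraic_fps F \<Longrightarrow> algebraic_fps H \<Longrightarrow> algebraic_fps (F * H)"
  by (simp add: algebraic_fps_def algebraic_fract_mult)

lemma algebraic_fps_uminus [intro]: "algebraic_fps F \<Longrightarrow> algebraic_fps (- F)"
  using algebraic_fps_mult[OF algebraic_fps_const[of "-1"], of F]
  by (simp add: fps_const_neg[symmetric] del: fps_const_neg)

lemma algebraic_fps_diff [intro]: "algebraic_fps F \<Longrightarrow> algebraic_fps H \<Longrightarrow> algebraic_fps (F - H)"
  using algebraic_fps_add[of F "- H"] by auto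

lemma algebraic_fps_power [intro]: "algebraic_fps F \<Longrightarrow> algebraic_fps (F ^ n)"
  by (induction n) auto

lemma algebraic_fps_divide:
  assumes "F * H = K" "F \<noteq> 0" "algebraic_fps F" "algebraic_fps K"
  shows "algebraic_fps H"
proof -
  have "to_fract H = to_fract K * inverse (to_fract F)"
    using assms(2) unfolding assms(1)[symmetric] by simp
  thus ?thesis using assms unfolding algebraic_fps_def
    by (simp add: algebraic_fract_mult algebraic_fract_inverse)
qed

section \<open>Roots of polynomial equations\<close>

text \<open>The condition on \<open>p1\<close> makes the polynomial nonzero whatever the other
  coefficients are; its degree may be below three.\<close>

lemma algebraic_fps_cubic_root:
  assumes "fps_of_poly p0 + fps_of_poly p1 * F + fps_of_poly p2 * F ^ 2 + fps_of_poly p3 * F ^ 3 = 0"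
    and "p1 \<noteq> 0"
  shows "algebraic_fps F"
proof -
  let ?e = "\<lambda>p :: complex poly poly poly. to_fract (fps_of_poly p)"
  let ?p = "[:?e p0, ?e p1, ?e p2, ?e p3:]"
  note mem = fps_of_poly_rational
  note mem0 = zero_rational
  have "(ring.algebraic type_ring over rational_functions) (to_fract F)"
  proof (rule algebraic_over_type_algebraI[of ?p])
    show "poly.coeff ?p i \<in> rational_functions" for i
      by (auto simp: coeff_pCons mem mem0 split: nat.split)
    have "?e p1 \<noteq> 0" using assms(2) fps_of_poly_eq_iff[of p1 0] by simp
    thus "?p \<noteq> 0" by auto
    have "poly ?p (to_fract F) = to_fract (fps_of_poly p0 + fps_of_poly p1 * F
        + fps_of_poly p2 * F ^ 2 + fps_of_poly p3 * F ^ 3)"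
      by (simp add: algebra_simps power2_eq_square power3_eq_cube)
    thus "poly ?p (to_fract F) = 0" unfolding assms by simp
  qed
  thus ?thesis by (simp add: algebraic_fps_def algebraic_fract_def)
qed

text \<open>Converse of \<open>algebraic_over_type_algebraI\<close>. The list polynomials have the
  leading coefficient first, hence the reversal.\<close>

lemma algebraic_fractE:
  assumes "algebraic_fract z"
  obtains p where "\<And>i. poly.coeff p i \<in> rational_functions" "p \<noteq> 0" "poly p z = 0"
proof -
  interpret R: field type_ring by rule
  have car: "carrier type_ring = UNIV" and one: "\<one>\<^bsub>type_ring\<^esub> = 1" and zero: "\<zero>\<^bsub>type_ring\<^esub> = 0"
    and mult: "\<And>x y. x \<otimes>\<^bsub>type_ring\<^esub> y = x * y" and add: "\<And>x y. x \<oplus>\<^bsub>type_ring\<^esub> y = x + y"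
    by (simp_all add: ring_of_type_algebra_def)
  have pow: "y [^]\<^bsub>type_ring\<^esub> n = y ^ n" for y and n :: nat
    by (induction n) (simp_all add: one mult)
  have eval: "R.eval (rev xs) z = poly (Poly xs) z" for xs
    by (induction xs rule: rev_induct)
      (simp_all add: zero mult add pow Poly_snoc poly_monom)
  obtain xs where xs: "xs \<in> carrier (rational_functions [X]\<^bsub>type_ring\<^esub>)" "xs \<noteq> []" "R.eval xs z = 0"
    using R.algebraicE[OF subfieldE(1)[OF subfield_rational_functions], of z] assms
    unfolding algebraic_fract_def car zero by blast
  have set: "set xs \<subseteq> rational_functions" and hd: "hd xs \<noteq> 0"
    using xs(1,2) by (auto simp: univ_poly_def polynomial_def zero)
  note mem0 = zero_rational
  show thesis
  proof (rule that[of "Poly (rev xs)"])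
    show "poly.coeff (Poly (rev xs)) i \<in> rational_functions" for i
    proof (cases "i < length xs")
      case True
      hence "rev xs ! i \<in> set xs" using nth_mem[of i "rev xs"] by simp
      thus ?thesis using set True by (auto simp: nth_default_def)
    qed (simp add: nth_default_def mem0)
    have "poly.coeff (Poly (rev xs)) (length xs - 1) = hd xs"
      using xs(2) by (simp add: nth_default_def rev_nth hd_conv_nth)
    thus "Poly (rev xs) \<noteq> 0" using hd by (metis coeff_0)
    show "poly (Poly (rev xs)) z = 0" using eval[of "rev xs"] xs(3) by simp
  qed
qed

text \<open>If \<open>p\<close> annihilates the square of \<open>z\<close>, then \<open>p\<close>
  composed with the squaring polynomial annihilates \<open>z\<close>.\<close>

lemma algebraic_fract_sqrt:
  assumes "algebraic_fract (z\<^sup>2)"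
  shows "algebraic_fract z"
proof -
  obtain p where p: "\<And>i. poly.coeff p i \<in> rational_functions" "p \<noteq> 0" "poly p (z\<^sup>2) = 0"
    using algebraic_fractE[OF assms] by blast
  note mem0 = zero_rational
  have "\<forall>i. poly.coeff (pcompose p [:0, 0, 1:]) i \<in> rational_functions"
    using p(1)
  proof (induction p)
    case (pCons r p)
    have "poly.coeff p i \<in> rational_functions" for i
      using pCons.prems[of "Suc i"] by simp
    moreover have "r \<in> rational_functions" using pCons.prems[of 0] by simp
    ultimately show ?case
      using pCons.IH mem0 by (auto simp: pcompose_pCons coeff_pCons split: nat.split)
  qed (simp add: mem0)
  moreover have "pcompose p [:0, 0, 1:] \<noteq> 0"
    using pcompose_eq_0[of p "[:0, 0, 1:]"] p(2) by auto
  moreover have "poly (pcompose p [:0, 0, 1:]) z = 0"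
    using p(3) by (simp add: poly_pcompose power2_eq_square)
  ultimately show ?thesis
    unfolding algebraic_fract_def by (intro algebraic_over_type_algebraI) auto
qed

lemma algebraic_fps_sqrt: "algebraic_fps (F\<^sup>2) \<Longrightarrow> algebraic_fps F"
  unfolding algebraic_fps_def by (rule algebraic_fract_sqrt) (simp add: power2_eq_square)


section \<open>Kernel identities\<close>

text \<open>This is \<open>x y (1 - t (x + y + 1 / (x y)))\<close>, the kernel of the step set
  cleared of denominators.\<close>

definition rk_kernel :: "'a::idom \<Rightarrow> 'a \<Rightarrow> 'a \<Rightarrow> 'a"
  where "rk_kernel t x y = x * y - t * (x\<^sup>2 * y + x * y\<^sup>2 + 1)"

definition invariant_num :: "'a::idom \<Rightarrow> 'a \<Rightarrow> 'a"
  where "invariant_num t x = t * x ^ 3 - x\<^sup>2 - t"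

definition axis_factor :: "'a::idom \<Rightarrow> 'a \<Rightarrow> 'a \<Rightarrow> 'a"
  where "axis_factor a t x = (a - 1) - a * t * x"

text \<open>
  On the curve, \<open>axis_factor_norm a t x / x\<close> is \<open>\<lambda>\<^sub>a(x) \<lambda>\<^sub>a(y) \<lambda>\<^sub>a(z)\<close>; likewise
  \<open>invariant_num t x / x\<close> is \<open>I(x)\<close>.
\<close>

definition axis_factor_norm :: "'a::idom \<Rightarrow> 'a \<Rightarrow> 'a \<Rightarrow> 'a"
  where "axis_factor_norm a t x = - (a - 1)\<^sup>2 * x - (a - 1) * a\<^sup>2 * t * invariant_num t x - a ^ 3 * t ^ 3 * x"

lemma invariant_num_cong: "y * invariant_num t x - x * invariant_num t y = - (x - y) * rk_kernel t x y"
  unfolding invariant_num_def rk_kernel_def by (simp add: algebra_simps eval_nat_numeral)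

text \<open>The first factor is \<open>x y \<lambda>\<^sub>a(z)\<close> with
  \<open>z = 1 / (x y)\<close>. On the curve the elementary symmetric functions of
  \<open>x, y, z\<close> are \<open>1 / t\<close>, \<open>- I / t\<close> and \<open>1\<close>,
  which gives the norm.\<close>

lemma axis_factor_norm_eq:
  "((a - 1) * x * y - a * t) * axis_factor a t x * axis_factor a t y =
     y * axis_factor_norm a t x + a * (a - 1) * axis_factor a t x * rk_kernel t x y"
  unfolding invariant_num_def rk_kernel_def axis_factor_def axis_factor_norm_def by (simp add: algebra_simps eval_nat_numeral)

text \<open>Twice the functional equation times
  \<open>\<lambda>\<^sub>a(y) \<lambda>\<^sub>b(x)\<close>, sorted by variable. After
  \<open>t^2 x y\<close> is expressed through \<open>I(x) + I(y)\<close>, the coefficients of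
  \<open>1 / x\<close> and \<open>1 / y\<close> have mean \<open>t R\<close>, absorbed by the gluing
  function; half their difference enters \<open>S\<close> and \<open>S'\<close> with opposite signs
  and is absorbed by \<open>I(x) - I(y)\<close>.\<close>

lemma decouple:
  fixes t x y a b \<mu> \<nu> Q A B C C' Tx Ty E :: "'a::idom"
  assumes FE: "rk_kernel t x y * Q = ((a - 1) * x * y - a * t) * A + ((b - 1) * x * y - b * t) * B
      + x * y * \<mu> - t * \<nu>"
    and C: "((a - 1) * x * y - a * t) * axis_factor a t y * A = x * y * C + a * (a - 1) * rk_kernel t x y * A"
    and C': "((b - 1) * x * y - b * t) * axis_factor b t x * B = x * y * C' + b * (b - 1) * rk_kernel t x y * B"
    and E: "y * (t + x * Tx) + x * (t + y * Ty) = rk_kernel t x y * E"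
    and R: "R = t * (\<nu> * (2 * a * b - a - b) - \<mu> * a * b)"
    and S: "S = t * (\<mu> * a * b + \<nu> * (a - b))"
    and S': "S' = t * (\<mu> * a * b - \<nu> * (a - b))"
  shows "x * y * ((2 * axis_factor b t x * C + 2 * ((a - 1) * (b - 1) * (\<mu> - \<nu>) - \<nu> * a * b * t ^ 3)
            + 2 * (\<nu> * (a - 1) * (b - 1) - \<mu> * (a - 1) * b) * t * x - R * Tx - S * (t * x\<^sup>2 - x))
         + (2 * axis_factor a t y * C' + 2 * (\<nu> * (a - 1) * (b - 1) - \<mu> * a * (b - 1)) * t * y
            - R * Ty - S' * (t * y\<^sup>2 - y)))
     = rk_kernel t x y * (2 * axis_factor a t y * axis_factor b t x * Q - 2 * axis_factor b t x * a * (a - 1) * A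
         - 2 * axis_factor a t y * b * (b - 1) * B - R * E - S' * (x - y)
         - 2 * (\<nu> * (a - 1) * (b - 1) - \<mu> * a * b * t * x))"
    (is "x * y * (?U + ?V) = ?K * ?G")
proof -
  \<comment> \<open>Each bracket on the right is the difference of the two sides of one hypothesis;
    what remains is a polynomial identity.\<close>
  have "x * y * (?U + ?V) - ?K * ?G
    = 2 * axis_factor b t x * (x * y * C + a * (a - 1) * ?K * A - ((a - 1) * x * y - a * t) * axis_factor a t y * A)
    + 2 * axis_factor a t y * (x * y * C' + b * (b - 1) * ?K * B - ((b - 1) * x * y - b * t) * axis_factor b t x * B)
    - 2 * axis_factor a t y * axis_factor b t x * (?K * Q - (((a - 1) * x * y - a * t) * A
         + ((b - 1) * x * y - b * t) * B + x * y * \<mu> - t * \<nu>))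
    - R * (y * (t + x * Tx) + x * (t + y * Ty) - ?K * E)"
    unfolding R S S' invariant_num_def rk_kernel_def axis_factor_def by (simp add: algebra_simps eval_nat_numeral)
  thus ?thesis using FE C C' E by simp
qed

text \<open>Divided by \<open>x^2\<close>, the right side is a quadratic polynomial in
  \<open>I(x)\<close> with coefficients free of \<open>x\<close>. The hypotheses give
  \<open>m v = 1\<close>.\<close>

lemma gluing_square:
  fixes t v x m G :: "'a::idom"
  assumes v: "v = 1 + 4 * t ^ 3 * v ^ 3" and m: "m = 1 - 4 * t ^ 3 * v\<^sup>2"
    and G: "G\<^sup>2 = 1 - t * v * (v + 1) * x + t\<^sup>2 * v\<^sup>2 * x\<^sup>2"
  shows "((t + 2 * t\<^sup>2 * v * x - m * x\<^sup>2) * G)\<^sup>2 =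
     (invariant_num t x)\<^sup>2 - t\<^sup>2 * v * (3 - v) * x * invariant_num t x
     + (t ^ 4 * v\<^sup>2 - 4 * t ^ 4 * v ^ 3 - 2 * t * m - 2 * t) * x\<^sup>2"
proof -
  have "((t + 2 * t\<^sup>2 * v * x - m * x\<^sup>2) * G)\<^sup>2 = (t + 2 * t\<^sup>2 * v * x - m * x\<^sup>2)\<^sup>2 * G\<^sup>2"
    by (simp add: power_mult_distrib)
  moreover define r where "r = v - 1 - 4 * t ^ 3 * v ^ 3"
  \<comment> \<open>Before the equation of \<open>v\<close> is used, the two sides differ by a
    multiple of its defect \<open>r\<close>.\<close>
  have "(t + 2 * t\<^sup>2 * v * x - m * x\<^sup>2)\<^sup>2 * (1 - t * v * (v + 1) * x + t\<^sup>2 * v\<^sup>2 * x\<^sup>2)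
    - ((invariant_num t x)\<^sup>2 - t\<^sup>2 * v * (3 - v) * x * invariant_num t x
       + (t ^ 4 * v\<^sup>2 - 4 * t ^ 4 * v ^ 3 - 2 * t * m - 2 * t) * x\<^sup>2)
    = r * (t\<^sup>2 * (m * v + 1) * x ^ 6 - t * (3 + r) * x ^ 5 + t ^ 3 * v * (4 * v - 3) * x ^ 4
           + t\<^sup>2 * (3 * v - 2) * x ^ 3)"
    unfolding m r_def invariant_num_def by (simp add: algebra_simps eval_nat_numeral)
  moreover have "r = 0" unfolding r_def using v by (metis add_diff_cancel_left' diff_self)
  ultimately show ?thesis unfolding G by simp
qed

section \<open>Weighted walks\<close>

text \<open>The weight of arriving at a point; the starting vertex is not an arrival and gets weight
  \<open>1\<close>.\<close>

definition point_weight :: "'a \<Rightarrow> 'a \<Rightarrow> 'a \<Rightarrow> int \<times> int \<Rightarrow> 'a::comm_ring_1"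
  where "point_weight a b c p =
    (if p = (0, 0) then c else if snd p = 0 then a else if fst p = 0 then b else 1)"

definition walk_weight :: "'a \<Rightarrow> 'a \<Rightarrow> 'a \<Rightarrow> (int \<times> int) list \<Rightarrow> 'a::comm_ring_1"
  where "walk_weight a b c w = a ^ horizontal_visits w * b ^ vertical_visits w * c ^ origin_visits w"

definition walks_to :: "(int \<times> int) set \<Rightarrow> nat \<Rightarrow> int \<times> int \<Rightarrow> (int \<times> int) list set"
  where "walks_to S n p = {w \<in> quarter_walks S n. vertex w n = p}"

definition weight_to :: "(int \<times> int) set \<Rightarrow> 'a \<Rightarrow> 'a \<Rightarrow> 'a \<Rightarrow> nat \<Rightarrow> int \<times> int \<Rightarrow> 'a::comm_ring_1"
  where "weight_to S a b c n p = (\<Sum>w\<in>walks_to S n p. walk_weight a b c w)"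

section \<open>Recursion over the last step\<close>

lemma finite_quarter_walks: "finite S \<Longrightarrow> finite (quarter_walks S n)"
  unfolding quarter_walks_def
  by (rule finite_subset[OF _ finite_lists_length_eq[of S n]]) auto

lemma finite_walks_to: "finite S \<Longrightarrow> finite (walks_to S n p)"
  by (simp add: walks_to_def finite_quarter_walks)

lemma vertex_snoc:
  "vertex (w @ [s]) i = (if i \<le> length w then vertex w i else vertex w (length w) + s)"
  by (simp add: vertex_def)

text \<open>One statement for all three visit counts: \<open>P\<close> tests the position, and
  \<open>Q\<close> tests the time, so that the origin count can leave out time
  \<open>0\<close>.\<close>

lemma card_visits_snoc:
  "card {i. Q i \<and> i \<le> length (w @ [s]) \<and> P (vertex (w @ [s]) i)} =
   card {i. Q i \<and> i \<le> length w \<and> P (vertex w i)} +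
     (if Q (Suc (length w)) \<and> P (vertex w (length w) + s) then 1 else 0)"
proof -
  let ?n = "length w"
  have "{i. Q i \<and> i \<le> length (w @ [s]) \<and> P (vertex (w @ [s]) i)} =
    {i. Q i \<and> i \<le> ?n \<and> P (vertex w i)} \<union>
    (if Q (Suc ?n) \<and> P (vertex w ?n + s) then {Suc ?n} else {})"
    by (auto simp: vertex_snoc le_Suc_eq split: if_splits)
  thus ?thesis by (simp add: card_insert_if)
qed

lemma walk_weight_snoc:
  assumes "0 \<le> fst (vertex w (length w) + s)" "0 \<le> snd (vertex w (length w) + s)"
  shows "walk_weight a b c (w @ [s]) =
    point_weight a b c (vertex w (length w) + s) * walk_weight a b c w"
proof -
  have h: "horizontal_visits (w @ [s]) = horizontal_visits w +
      (if 0 < fst (vertex w (length w) + s) \<and> snd (vertex w (length w) + s) = 0 then 1 else 0)"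
    using card_visits_snoc[of "\<lambda>_. True" w s "\<lambda>p. 0 < fst p \<and> snd p = 0"]
    unfolding horizontal_visits_def by simp
  have v: "vertical_visits (w @ [s]) = vertical_visits w +
      (if fst (vertex w (length w) + s) = 0 \<and> 0 < snd (vertex w (length w) + s) then 1 else 0)"
    using card_visits_snoc[of "\<lambda>_. True" w s "\<lambda>p. fst p = 0 \<and> 0 < snd p"]
    unfolding vertical_visits_def by simp
  have u: "origin_visits (w @ [s]) = origin_visits w +
      (if vertex w (length w) + s = (0, 0) then 1 else 0)"
    using card_visits_snoc[of "\<lambda>i. 1 \<le> i" w s "\<lambda>p. p = (0, 0)"]
    unfolding origin_visits_def by simp
  show ?thesis
    using assms unfolding walk_weight_def h v u point_weight_def
    by (cases "vertex w (length w) + s") (auto simp: zero_prod_def)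
qed

lemma quarter_walks_snoc:
  "w @ [s] \<in> quarter_walks S (Suc n) \<longleftrightarrow> w \<in> quarter_walks S n \<and> s \<in> S \<and>
     0 \<le> fst (vertex w n + s) \<and> 0 \<le> snd (vertex w n + s)"
proof -
  have "w @ [s] \<in> quarter_walks S (Suc n) \<longleftrightarrow> length w = n \<and> set w \<subseteq> S \<and> s \<in> S \<and>
      (\<forall>i\<le>Suc n. 0 \<le> fst (vertex (w @ [s]) i) \<and> 0 \<le> snd (vertex (w @ [s]) i))"
    by (auto simp: quarter_walks_def)
  also have "\<dots> \<longleftrightarrow> length w = n \<and> set w \<subseteq> S \<and> s \<in> S \<and>
      (\<forall>i\<le>n. 0 \<le> fst (vertex w i) \<and> 0 \<le> snd (vertex w i)) \<and>
      0 \<le> fst (vertex w n + s) \<and> 0 \<le> snd (vertex w n + s)"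
    by (auto simp: vertex_snoc le_Suc_eq)
  finally show ?thesis by (auto simp: quarter_walks_def)
qed

lemma weight_to_0: "weight_to S a b c 0 p = (if p = (0, 0) then 1 else 0)"
proof -
  have "walks_to S 0 p = (if p = (0, 0) then {[]} else {})"
    by (auto simp: walks_to_def quarter_walks_def vertex_def zero_prod_def)
  moreover have "origin_visits [] = 0"
    unfolding origin_visits_def by (rule card_eq_0_iff[THEN iffD2]) auto
  ultimately show ?thesis
    by (simp add: weight_to_def walk_weight_def horizontal_visits_def vertical_visits_def
        vertex_def zero_prod_def)
qed

lemma weight_to_outside:
  assumes "fst p < 0 \<or> snd p < 0"
  shows "weight_to S a b c n p = 0"
proof -
  have False if "w \<in> walks_to S n p" for w
    using that assms unfolding walks_to_def quarter_walks_def by auto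
  hence "walks_to S n p = {}" by blast
  thus ?thesis by (simp add: weight_to_def)
qed

lemma weight_to_far:
  assumes "S \<subseteq> {-1, 0, 1} \<times> {-1, 0, 1}" "int n < fst p \<or> int n < snd p"
  shows "weight_to S a b c n p = 0"
proof -
  have False if "w \<in> walks_to S n p" for w
  proof -
    have "set w \<subseteq> {-1, 0, 1} \<times> {-1, 0, 1}" "length w = n" "vertex w n = p"
      using that assms(1) by (auto simp: walks_to_def quarter_walks_def)
    thus False using vertex_bound[of w n] assms(2) by auto
  qed
  hence "walks_to S n p = {}" by blast
  thus ?thesis by (simp add: weight_to_def)
qed

text \<open>A walk to \<open>p\<close> is a last step \<open>s\<close> after a walk to
  \<open>p - s\<close>. The weight of the final vertex depends on \<open>p\<close> alone and factors
  out.\<close>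

lemma weight_to_Suc:
  assumes "finite S" "0 \<le> fst p" "0 \<le> snd p"
  shows "weight_to S a b c (Suc n) p = point_weight a b c p * (\<Sum>s\<in>S. weight_to S a b c n (p - s))"
proof -
  have *: "walks_to S (Suc n) p = (\<Union>s\<in>S. (\<lambda>w. w @ [s]) ` walks_to S n (p - s))"
  proof (intro equalityI subsetI)
    fix w assume w: "w \<in> walks_to S (Suc n) p"
    then obtain w' s where ws: "w = w' @ [s]"
      by (metis (mono_tags, lifting) mem_Collect_eq length_Suc_conv_rev quarter_walks_def walks_to_def)
    have "w' \<in> quarter_walks S n" "s \<in> S"
      using w unfolding ws walks_to_def by (auto simp: quarter_walks_snoc)
    moreover have "vertex w' n = p - s"
      using w \<open>w' \<in> _\<close> unfolding ws walks_to_def by (auto simp: quarter_walks_def vertex_snoc)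
    ultimately show "w \<in> (\<Union>s\<in>S. (\<lambda>w. w @ [s]) ` walks_to S n (p - s))"
      by (auto simp: ws walks_to_def)
  next
    fix w assume "w \<in> (\<Union>s\<in>S. (\<lambda>w. w @ [s]) ` walks_to S n (p - s))"
    then obtain w' s where "s \<in> S" "w = w' @ [s]" "w' \<in> quarter_walks S n" "vertex w' n = p - s"
      by (auto simp: walks_to_def)
    thus "w \<in> walks_to S (Suc n) p"
      using assms by (auto simp: walks_to_def quarter_walks_snoc) (simp add: vertex_snoc quarter_walks_def)
  qed
  have inj: "inj_on (\<lambda>w. w @ [s]) A" for s :: "int \<times> int" and A
    by (auto simp: inj_on_def)
  have "weight_to S a b c (Suc n) p =
      (\<Sum>s\<in>S. \<Sum>w\<in>(\<lambda>w. w @ [s]) ` walks_to S n (p - s). walk_weight a b c w)"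
    unfolding weight_to_def *
    by (rule sum.UNION_disjoint) (use assms in \<open>auto simp: finite_walks_to\<close>)
  also have "\<dots> = (\<Sum>s\<in>S. \<Sum>w\<in>walks_to S n (p - s). walk_weight a b c (w @ [s]))"
    by (simp add: sum.reindex[OF inj])
  also have "\<dots> = (\<Sum>s\<in>S. \<Sum>w\<in>walks_to S n (p - s). point_weight a b c p * walk_weight a b c w)"
  proof (intro sum.cong refl)
    fix s w assume "w \<in> walks_to S n (p - s)"
    hence "vertex w (length w) + s = p" by (auto simp: walks_to_def quarter_walks_def)
    thus "walk_weight a b c (w @ [s]) = point_weight a b c p * walk_weight a b c w"
      using walk_weight_snoc[of w s] assms by simp
  qed
  finally show ?thesis by (simp add: weight_to_def sum_distrib_left)
qed

section \<open>From visit counts to weights\<close>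

text \<open>Each cardinality is expanded into a sum of indicators over \<open>A\<close>, and this
  sum is moved outside by three exchanges.\<close>

lemma sum_by_three_statistics:
  fixes f g h :: "'b \<Rightarrow> nat" and F :: "nat \<Rightarrow> nat \<Rightarrow> nat \<Rightarrow> 'a::comm_ring_1"
  assumes "finite A" "\<And>w. w \<in> A \<Longrightarrow> f w \<le> n \<and> g w \<le> n \<and> h w \<le> n"
  shows "(\<Sum>i\<le>n. \<Sum>j\<le>n. \<Sum>k\<le>n. of_nat (card {w \<in> A. f w = i \<and> g w = j \<and> h w = k}) * F i j k)
    = (\<Sum>w\<in>A. F (f w) (g w) (h w))"
proof -
  have c: "of_nat (card {w \<in> A. f w = i \<and> g w = j \<and> h w = k}) * F i j k =
      (\<Sum>w\<in>A. if f w = i \<and> g w = j \<and> h w = k then F i j k else 0)" for i j k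
    using assms(1) by (simp add: sum.If_cases Int_def)
  have "(\<Sum>i\<le>n. \<Sum>j\<le>n. \<Sum>k\<le>n. of_nat (card {w \<in> A. f w = i \<and> g w = j \<and> h w = k}) * F i j k)
    = (\<Sum>i\<le>n. \<Sum>j\<le>n. \<Sum>k\<le>n. \<Sum>w\<in>A. if f w = i \<and> g w = j \<and> h w = k then F i j k else 0)"
    unfolding c ..
  also have "\<dots> = (\<Sum>i\<le>n. \<Sum>j\<le>n. \<Sum>w\<in>A. \<Sum>k\<le>n. if f w = i \<and> g w = j \<and> h w = k then F i j k else 0)"
    by (rule sum.cong[OF refl], rule sum.cong[OF refl], rule sum.swap)
  also have "\<dots> = (\<Sum>i\<le>n. \<Sum>w\<in>A. \<Sum>j\<le>n. \<Sum>k\<le>n. if f w = i \<and> g w = j \<and> h w = k then F i j k else 0)"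
    by (rule sum.cong[OF refl], rule sum.swap)
  also have "\<dots> = (\<Sum>w\<in>A. \<Sum>i\<le>n. \<Sum>j\<le>n. \<Sum>k\<le>n. if f w = i \<and> g w = j \<and> h w = k then F i j k else 0)"
    by (rule sum.swap)
  also have "\<dots> = (\<Sum>w\<in>A. F (f w) (g w) (h w))"
  proof (intro sum.cong refl)
    fix w assume w: "w \<in> A"
    have "(\<Sum>k\<le>n. if f w = i \<and> g w = j \<and> h w = k then F i j k else 0) =
        (if f w = i then if g w = j then F i j (h w) else 0 else 0)" for i j
      using assms(2)[OF w] by auto
    moreover have "(\<Sum>j\<le>n. if f w = i then if g w = j then F i j (h w) else 0 else 0) =
        (if f w = i then F i (g w) (h w) else 0)" for i
      using assms(2)[OF w] by auto
    ultimately show "(\<Sum>i\<le>n. \<Sum>j\<le>n. \<Sum>k\<le>n. if f w = i \<and> g w = j \<and> h w = k then F i j k else 0)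
      = F (f w) (g w) (h w)"
      using assms(2)[OF w] by simp
  qed
  finally show ?thesis .
qed

lemma coeff_walk_gf:
  assumes S: "S \<subseteq> {-1, 0, 1} \<times> {-1, 0, 1}"
  shows "poly.coeff (poly.coeff (walk_gf S a b c $ n) l) k
    = (weight_to S a b c n (int k, int l) :: 'a::comm_ring_1)"
proof -
  have fin: "finite S" by (rule finite_subset[OF S]) simp
  let ?X = "\<lambda>k l. \<Sum>h\<le>n. \<Sum>v\<le>n. \<Sum>u\<le>n. of_nat (walk_count S n k l h v u) * a ^ h * b ^ v * c ^ u"
  have X: "?X k l = weight_to S a b c n (int k, int l)" for k l
  proof -
    have bd: "horizontal_visits w \<le> n \<and> vertical_visits w \<le> n \<and> origin_visits w \<le> n"
      if "w \<in> walks_to S n (int k, int l)" for w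
    proof -
      have "w \<in> {w \<in> quarter_walks S n. vertex w n = (int k, int l) \<and>
        horizontal_visits w = horizontal_visits w \<and> vertical_visits w = vertical_visits w
        \<and> origin_visits w = origin_visits w}"
        using that by (simp add: walks_to_def)
      hence "walk_count S n k l (horizontal_visits w) (vertical_visits w) (origin_visits w) \<noteq> 0"
        unfolding walk_count_def using finite_quarter_walks[OF fin, of n] that
        by (auto simp: card_eq_0_iff walks_to_def)
      from walk_count_nonzero_imp_le[OF S this] show ?thesis by blast
    qed
    have wc: "walk_count S n k l h v u = card {w \<in> walks_to S n (int k, int l).
        horizontal_visits w = h \<and> vertical_visits w = v \<and> origin_visits w = u}" for h v u
      unfolding walk_count_def walks_to_def by (rule arg_cong[where f = card]) auto
    show ?thesis
      unfolding wc weight_to_def walk_weight_def mult.assoc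
      by (rule sum_by_three_statistics[OF finite_walks_to[OF fin] bd, where F = "\<lambda>h v u. a ^ h * (b ^ v * c ^ u)"])
  qed
  have gf: "walk_gf S a b c $ n = (\<Sum>k\<le>n. \<Sum>l\<le>n. Polynomial.monom (Polynomial.monom (?X k l) k) l)"
    unfolding walk_gf_def by (simp add: monom_sum)
  have "poly.coeff (poly.coeff (walk_gf S a b c $ n) l) k =
      (\<Sum>i\<le>n. if i = k then (\<Sum>j\<le>n. if j = l then weight_to S a b c n (int i, int j) else 0) else 0)"
    unfolding gf X by (auto simp: coeff_sum intro!: sum.cong)
  also have "\<dots> = (if k \<le> n \<and> l \<le> n then weight_to S a b c n (int k, int l) else 0)"
    by simp
  also have "\<dots> = weight_to S a b c n (int k, int l)"
    using weight_to_far[OF S, of n "(int k, int l)"] by auto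
  finally show ?thesis .
qed

section \<open>Evaluation of bivariate series\<close>

definition cst :: "complex \<Rightarrow> complex poly poly fps" where "cst r = fps_const [:[:r:]:]"
definition xv :: "complex poly poly fps" where "xv = fps_const [:[:0, 1:]:]"
definition yv :: "complex poly poly fps" where "yv = fps_const [:0, 1:]"

definition eval_poly :: "complex poly poly fps \<Rightarrow> complex poly \<Rightarrow> complex poly poly fps"
  where "eval_poly z p = poly (map_poly cst p) z"

text \<open>Series in \<open>t\<close> and one further variable live in
  \<open>complex poly fps\<close>, so that one and the same series can be evaluated at
  \<open>xv\<close>, at \<open>yv\<close>, at \<open>0\<close> and at algebraic series.\<close>

definition eval_fps :: "complex poly poly fps \<Rightarrow> complex poly fps \<Rightarrow> complex poly poly fps"
  where "eval_fps z = fps_hom_ext (eval_poly z)"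

definition embed_series :: "complex fps \<Rightarrow> complex poly poly fps"
  where "embed_series = fps_hom_ext cst"

definition coef_fps :: "complex fps \<Rightarrow> complex poly fps"
  where "coef_fps s = Abs_fps (\<lambda>n. [:s $ n:])"

lemma cst_0 [simp]: "cst 0 = 0" and cst_1 [simp]: "cst 1 = 1"
  by (simp_all add: cst_def pCons_one)

lemma cst_add: "cst (r + s) = cst r + cst s"
  and cst_mult: "cst (r * s) = cst r * cst s"
  and cst_diff: "cst (r - s) = cst r - cst s"
  and cst_uminus: "cst (- r) = - cst r"
  by (simp_all add: cst_def)

lemma cst_numeral [simp]: "cst (numeral k) = numeral k"
proof (induction k)
  case (Bit0 k) thus ?case by (simp only: numeral_Bit0 cst_add)
next
  case (Bit1 k) thus ?case by (simp only: numeral_Bit1 cst_add cst_1)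
qed simp

section \<open>Evaluation as a ring homomorphism\<close>

lemma eval_poly_0 [simp]: "eval_poly z 0 = 0"
  by (simp add: eval_poly_def)

lemma eval_poly_pCons: "eval_poly z (pCons r p) = cst r + z * eval_poly z p"
  by (simp add: eval_poly_def map_poly_pCons)

lemma eval_poly_add: "eval_poly z (p + q) = eval_poly z p + eval_poly z q"
  by (induction p q rule: poly_induct2) (simp_all add: eval_poly_pCons cst_add algebra_simps)

lemma eval_poly_smult: "eval_poly z (smult r p) = cst r * eval_poly z p"
  by (induction p) (simp_all add: eval_poly_pCons cst_mult algebra_simps)

interpretation eval_poly: hom_into_fps "eval_poly z" for z
proof
  show "eval_poly z 1 = 1"
    using eval_poly_pCons[of z 1 0] by (simp add: pCons_one)
  show "eval_poly z (p + q) = eval_poly z p + eval_poly z q" for p q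
    by (rule eval_poly_add)
  show "eval_poly z (p * q) = eval_poly z p * eval_poly z q" for p q
    by (induction p) (simp_all add: eval_poly_pCons eval_poly_add eval_poly_smult algebra_simps)
qed

interpretation cst: hom_into_fps cst
  by standard (simp_all add: cst_add cst_mult)

lemmas eval_fps_hom = eval_poly.ext_add[folded eval_fps_def] eval_poly.ext_mult[folded eval_fps_def]
  eval_poly.ext_diff[folded eval_fps_def] eval_poly.ext_uminus[folded eval_fps_def]
  eval_poly.ext_power[folded eval_fps_def] eval_poly.ext_X[folded eval_fps_def]
  eval_poly.ext_0[folded eval_fps_def] eval_poly.ext_1[folded eval_fps_def]

lemmas embed_series_hom = cst.ext_add[folded embed_series_def] cst.ext_mult[folded embed_series_def]
  cst.ext_diff[folded embed_series_def] cst.ext_uminus[folded embed_series_def]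
  cst.ext_power[folded embed_series_def] cst.ext_X[folded embed_series_def]
  cst.ext_0[folded embed_series_def] cst.ext_1[folded embed_series_def]

lemma eval_fps_numeral: "eval_fps z (numeral k) = numeral k"
proof (induction k)
  case (Bit0 k) thus ?case by (simp only: numeral_Bit0 eval_fps_hom)
next
  case (Bit1 k) thus ?case by (simp only: numeral_Bit1 eval_fps_hom numeral_One)
qed (simp only: numeral_One eval_fps_hom)

lemma eval_fps_const: "eval_fps z (fps_const [:r:]) = cst r"
  using eval_poly.ext_const[of z "[:r:]"] by (simp add: eval_fps_def eval_poly_pCons)

lemma eval_fps_var: "eval_fps z (fps_const [:0, 1:]) = z"
  using eval_poly.ext_const[of z "[:0, 1:]"] by (simp add: eval_fps_def eval_poly_pCons)

lemma eval_fps_coef_fps: "eval_fps z (coef_fps s) = embed_series s"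
  by (rule fps_ext) (simp add: eval_fps_def embed_series_def fps_hom_ext_def coef_fps_def eval_poly_pCons)

lemma fps_hom_ext_const_nth: "fps_hom_ext (\<lambda>p. fps_const (f p)) F $ n = f (F $ n)"
proof -
  have "fps_hom_ext (\<lambda>p. fps_const (f p)) F $ n = (\<Sum>i\<le>n. if i = n then f (F $ i) else 0)"
    unfolding fps_hom_ext_def by (auto intro!: sum.cong)
  thus ?thesis by simp
qed

lemma embed_series_nth: "embed_series s $ n = [:[:s $ n:]:]"
  unfolding embed_series_def cst_def by (rule fps_hom_ext_const_nth)

lemma eval_fps_xv_nth: "eval_fps xv F $ n = [:F $ n:]"
proof -
  have "eval_poly xv p = fps_const [:p:]" for p
    by (induction p) (simp_all add: eval_poly_pCons cst_def xv_def)
  hence "eval_poly xv = (\<lambda>p. fps_const [:p:])" by blast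
  thus ?thesis unfolding eval_fps_def by (simp only: fps_hom_ext_const_nth)
qed

lemma eval_fps_yv_nth: "eval_fps yv F $ n = map_poly (\<lambda>r. [:r:]) (F $ n)"
proof -
  have "eval_poly yv p = fps_const (map_poly (\<lambda>r. [:r:]) p)" for p
    by (induction p) (simp_all add: eval_poly_pCons cst_def yv_def map_poly_pCons)
  hence "eval_poly yv = (\<lambda>p. fps_const (map_poly (\<lambda>r. [:r:]) p))" by blast
  thus ?thesis unfolding eval_fps_def by (simp only: fps_hom_ext_const_nth)
qed

section \<open>The functional equation\<close>

lemma reverse_kreweras_small: "reverse_kreweras \<subseteq> {-1, 0, 1} \<times> {-1, 0, 1}"
  by (auto simp: reverse_kreweras_def)

text \<open>
  \<open>A\<close> and \<open>B\<close> count arrivals on the axes without the weight of the last vertex (divided by \<open>x\<close>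
  and \<open>y\<close>), and \<open>u\<close> likewise arrivals at the origin; this avoids dividing by \<open>a\<close>, \<open>b\<close> or \<open>c\<close>,
  which may be \<open>0\<close>.
\<close>

theorem functional_equation:
  fixes a b c :: complex
  obtains A B u where
    "rk_kernel fps_X xv yv * walk_gf reverse_kreweras a b c =
      ((cst a - 1) * xv * yv - cst a * fps_X) * (xv * eval_fps xv A)
      + ((cst b - 1) * xv * yv - cst b * fps_X) * (yv * eval_fps yv B)
      + xv * yv * (1 + (cst c - 1) * embed_series u) - fps_X * (1 + cst c * embed_series u)"
proof -
  define g where "g n i j = weight_to reverse_kreweras a b c n (int i, int j)" for n i j
  \<comment> \<open>Weight of the walks of \<open>n + 1\<close> steps ending at
    \<open>(i, j)\<close>, the final vertex left unweighted. The tests for \<open>0\<close> discard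
    predecessors with a negative coordinate.\<close>
  define arr where "arr n i j = g n (Suc i) (Suc j) + (if i = 0 then 0 else g n (i - 1) j)
      + (if j = 0 then 0 else g n i (j - 1))" for n i j
  define pw where "pw i j = point_weight a b c (int i, int j)" for i j
  have pw: "pw 0 0 = c" "pw (Suc i) 0 = a" "pw 0 (Suc j) = b" "pw (Suc i) (Suc j) = 1" for i j
    by (simp_all add: pw_def point_weight_def)
  have g0: "g 0 i j = (if i = 0 \<and> j = 0 then 1 else 0)" for i j
    by (simp add: g_def weight_to_0)
  have gS: "g (Suc n) i j = pw i j * arr n i j" for n i j
  proof -
    let ?w = "weight_to reverse_kreweras a b c n"
    have "(\<Sum>s\<in>reverse_kreweras. ?w ((int i, int j) - s)) =
        ?w ((int i, int j) - (-1, -1)) + ?w ((int i, int j) - (0, 1)) + ?w ((int i, int j) - (1, 0))"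
      by (simp add: reverse_kreweras_def)
    also have "?w ((int i, int j) - (-1, -1)) = g n (Suc i) (Suc j)"
      by (simp add: g_def add.commute)
    also have "?w ((int i, int j) - (0, 1)) = (if j = 0 then 0 else g n i (j - 1))"
      using weight_to_outside[of "(int i, int j) - (0, 1)" reverse_kreweras a b c n] by (simp add: g_def of_nat_diff)
    also have "?w ((int i, int j) - (1, 0)) = (if i = 0 then 0 else g n (i - 1) j)"
      using weight_to_outside[of "(int i, int j) - (1, 0)" reverse_kreweras a b c n] by (simp add: g_def of_nat_diff)
    finally show ?thesis
      unfolding g_def pw_def arr_def
      by (subst weight_to_Suc) (simp_all add: reverse_kreweras_def)
  qed
  have far: "g n i j = 0" if "n < i \<or> n < j" for n i j
    unfolding g_def using that by (intro weight_to_far[OF reverse_kreweras_small]) auto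
  have arr_far: "arr n i j = 0" if "Suc n < i \<or> Suc n < j" for n i j
  proof -
    have "g n (Suc i) (Suc j) = 0" "i \<noteq> 0 \<Longrightarrow> g n (i - 1) j = 0" "j \<noteq> 0 \<Longrightarrow> g n i (j - 1) = 0"
      using that by (auto intro!: far)
    thus ?thesis by (cases "i = 0"; cases "j = 0") (simp_all add: arr_def)
  qed
  define A where "A = Abs_fps (\<lambda>n. case n of 0 \<Rightarrow> 0 |
    Suc m \<Rightarrow> (\<Sum>k\<le>n. Polynomial.monom (arr m (Suc k) 0) k))"
  define B where "B = Abs_fps (\<lambda>n. case n of 0 \<Rightarrow> 0 |
    Suc m \<Rightarrow> (\<Sum>k\<le>n. Polynomial.monom (arr m 0 (Suc k)) k))"
  define u where "u = Abs_fps (\<lambda>n. case n of 0 \<Rightarrow> 0 | Suc m \<Rightarrow> arr m 0 0)"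
  have A: "A $ 0 = 0" "poly.coeff (A $ Suc m) k = arr m (Suc k) 0" for m k
    by (auto simp: A_def coeff_sum arr_far)
  have B: "B $ 0 = 0" "poly.coeff (B $ Suc m) k = arr m 0 (Suc k)" for m k
    by (auto simp: B_def coeff_sum arr_far)
  have u: "u $ 0 = 0" "u $ Suc m = arr m 0 0" for m
    by (simp_all add: u_def)
  have aA: "a * poly.coeff (A $ m) k = g m (Suc k) 0" for m k
    by (cases m) (simp_all add: A g0 gS pw)
  have bB: "b * poly.coeff (B $ m) k = g m 0 (Suc k)" for m k
    by (cases m) (simp_all add: B g0 gS pw)
  \<comment> \<open>The empty walk ends at the origin without being an arrival, hence the extra
    \<open>1\<close> at \<open>m = 0\<close>.\<close>
  have cu: "(if m = 0 then 1 else 0) + c * u $ m = g m 0 0" for m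
    by (cases m) (simp_all add: u g0 gS pw)
  let ?Q = "walk_gf reverse_kreweras a b c"
  have Q: "poly.coeff (poly.coeff (?Q $ n) j) i = g n i j" for n i j
    by (simp add: coeff_walk_gf[OF reverse_kreweras_small] g_def)
  have Q0: "?Q $ 0 = 1"
    by (intro poly_eqI) (simp add: Q g0 of_bool_def)
  define X' Y' :: "complex poly poly" where "X' = [:[:0, 1:]:]" and "Y' = [:0, 1:]"
  define k :: "complex \<Rightarrow> complex poly poly" where "k r = [:[:r:]:]" for r
  define A' B' where "A' n = [:A $ n:]" and "B' n = map_poly (\<lambda>r. [:r:]) (B $ n)" for n
  have cX: "poly.coeff (poly.coeff (X' * p) j) i = (case i of 0 \<Rightarrow> 0 | Suc i' \<Rightarrow> poly.coeff (poly.coeff p j) i')" for p i j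
    by (simp add: X'_def coeff_pCons)
  have cY: "poly.coeff (poly.coeff (Y' * p) j) i = (case j of 0 \<Rightarrow> 0 | Suc j' \<Rightarrow> poly.coeff (poly.coeff p j') i)" for p i j
    by (simp add: Y'_def coeff_pCons split: nat.split)
  have ck: "poly.coeff (poly.coeff (k r * p) j) i = r * poly.coeff (poly.coeff p j) i" for r p i j
    by (simp add: k_def)
  have k: "poly.coeff (poly.coeff (k r) j) i = (if i = 0 \<and> j = 0 then r else 0)" for r i j
    by (simp add: k_def coeff_pCons split: nat.split)
  have A': "poly.coeff (poly.coeff (A' n) j) i = (if j = 0 then poly.coeff (A $ n) i else 0)" for n i j
    by (simp add: A'_def coeff_pCons split: nat.split)
  have B': "poly.coeff (poly.coeff (B' n) j) i = (if i = 0 then poly.coeff (B $ n) j else 0)" for n i j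
    by (simp add: B'_def coeff_map_poly coeff_pCons split: nat.split)
  \<comment> \<open>The coefficient of \<open>t^(m+1)\<close> in the functional equation.\<close>
  have rec: "X' * (Y' * ?Q $ Suc m) - (X' * (X' * (Y' * ?Q $ m)) + X' * (Y' * (Y' * ?Q $ m)) + ?Q $ m)
    = k (a - 1) * (X' * (Y' * (X' * A' (Suc m)))) - k a * (X' * A' m)
    + (k (b - 1) * (X' * (Y' * (Y' * B' (Suc m)))) - k b * (Y' * B' m))
    + X' * (Y' * k ((c - 1) * u $ Suc m)) - k (g m 0 0)" (is "?l = ?r") for m
  proof (intro poly_eqI)
    fix i j
    show "poly.coeff (poly.coeff ?l j) i = poly.coeff (poly.coeff ?r j) i"
    \<comment> \<open>With both exponents positive this is the recursion at the vertex
      \<open>(i - 1, j - 1)\<close>, where \<open>a - 1\<close>, \<open>b - 1\<close>,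
      \<open>c - 1\<close> correct the weight on the boundary. The other monomials come from the
      diagonal step taken on the boundary, which would leave the quarter plane.\<close>
    proof (cases i; cases j)
      fix i' j' assume ij: "i = Suc i'" "j = Suc j'"
      show ?thesis unfolding ij
        by (cases i'; cases j'; simp add: cX cY ck k A' B' A B u Q gS pw arr_def;
            simp add: algebra_simps)
    qed (simp_all add: cX cY ck k A' B' Q aA bB split: nat.split)
  qed
  have "rk_kernel fps_X xv yv * ?Q =
      ((cst a - 1) * xv * yv - cst a * fps_X) * (xv * eval_fps xv A)
      + ((cst b - 1) * xv * yv - cst b * fps_X) * (yv * eval_fps yv B)
      + xv * yv * (1 + (cst c - 1) * embed_series u) - fps_X * (1 + cst c * embed_series u)" (is "?L = ?R")
  proof (rule fps_ext)
    fix n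
    define Ax By where "Ax = eval_fps xv A" and "By = eval_fps yv B"
    have nths: "Ax $ n = A' n" "By $ n = B' n" "embed_series u $ n = k (u $ n)" for n
      by (simp_all add: Ax_def By_def A'_def B'_def k_def eval_fps_xv_nth eval_fps_yv_nth embed_series_nth)
    have vars: "xv = fps_const X'" "yv = fps_const Y'" and cst: "cst r = fps_const (k r)" for r
      by (simp_all add: xv_def yv_def X'_def Y'_def cst_def k_def)
    have L: "?L = fps_const X' * (fps_const Y' * ?Q)
      - fps_X * (fps_const X' * (fps_const X' * (fps_const Y' * ?Q))
         + fps_const X' * (fps_const Y' * (fps_const Y' * ?Q)) + ?Q)"
      unfolding rk_kernel_def vars power2_eq_square by (simp only: algebra_simps mult_1_left mult_1_right)
    have k_one: "k 1 = 1" by (simp add: k_def pCons_one)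
    have k_diff: "k (r - s) = k r - k s" for r s by (simp add: k_def)
    have k1: "k (r - 1) = k r - 1" "k (r * s) = k r * k s" "k (r + s) = k r + k s" "k 0 = 0" for r s
      unfolding k_diff k_one by (simp_all add: k_def)
    have R: "?R = fps_const (k (a - 1)) * (fps_const X' * (fps_const Y' * (fps_const X' * Ax)))
        - fps_X * (fps_const (k a) * (fps_const X' * Ax))
        + (fps_const (k (b - 1)) * (fps_const X' * (fps_const Y' * (fps_const Y' * By)))
        - fps_X * (fps_const (k b) * (fps_const Y' * By)))
        + (fps_const X' * (fps_const Y' * (1 + fps_const (k (c - 1)) * embed_series u)))
        - fps_X * (1 + fps_const (k c) * embed_series u)"
      unfolding Ax_def[symmetric] By_def[symmetric] unfolding vars cst k1
      by (simp only: fps_const_sub[symmetric] fps_const_1_eq_1) (simp only: algebra_simps)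
    show "?L $ n = ?R $ n"
    proof (cases n)
      case 0
      thus ?thesis unfolding L R by (simp add: nths A'_def B'_def A B u Q0 k1 k_one)
    next
      case (Suc m)
      have X_nth: "(fps_X * F) $ Suc m = F $ m" for F :: "complex poly poly fps"
        by (simp add: fps_X_mult_nth)
      have one_nth: "(1 :: complex poly poly fps) $ m = k (if m = 0 then 1 else 0)"
        "(1 :: complex poly poly fps) $ Suc m = 0"
        by (simp_all add: k1 k_one)
      have "?L $ Suc m = X' * (Y' * ?Q $ Suc m)
          - (X' * (X' * (Y' * ?Q $ m)) + X' * (Y' * (Y' * ?Q $ m)) + ?Q $ m)"
        unfolding L by (simp only: fps_sub_nth fps_add_nth X_nth fps_mult_left_const_nth)
      moreover have "?R $ Suc m = k (a - 1) * (X' * (Y' * (X' * A' (Suc m)))) - k a * (X' * A' m)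
          + (k (b - 1) * (X' * (Y' * (Y' * B' (Suc m)))) - k b * (Y' * B' m))
          + X' * (Y' * k ((c - 1) * u $ Suc m)) - k (g m 0 0)"
        unfolding R cu[symmetric]
        by (simp only: fps_sub_nth fps_add_nth X_nth fps_mult_left_const_nth nths one_nth k1 add_0)
      ultimately show ?thesis unfolding Suc rec by simp
    qed
  qed
  thus thesis by (rule that)
qed

section \<open>The gluing function\<close>

text \<open>With the next lemma, this checks the hypothesis of \<open>fps_fixed_point\<close>:
  agreement below \<open>n\<close> passes through products, and a factor \<open>fps_X\<close> gains
  one coefficient.\<close>

lemma fps_mult_agree:
  assumes "\<And>i. i < n \<Longrightarrow> f $ i = f' $ i" "\<And>i. i < n \<Longrightarrow> g $ i = g' $ i" "i < n"
  shows "(f * g) $ i = (f' * g') $ (i :: nat)"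
  unfolding fps_mult_nth using assms by (intro sum.cong) auto

lemma fps_X_mult_agree:
  assumes "\<And>i. i < n \<Longrightarrow> f $ i = f' $ (i :: nat)"
  shows "(fps_X * f) $ n = (fps_X * (f' :: 'a::comm_ring_1 fps)) $ n"
  using assms by (cases n) (simp_all add: fps_X_mult_nth)

text \<open>
  The numerator \<open>t x D(x)\<close> of the gluing function is
  \<open>(t + 2 t^2 v x - m x^2) sqrt (1 - t v (v + 1) x + t^2 v^2 x^2)\<close> with \<open>v = 1 + 4 t^3 v^3\<close> and
  \<open>m = 1 / v = 1 - 4 t^3 v^2\<close>; here \<open>W = 2 t v\<close> is the classical parameter with \<open>W = t (2 + W^3)\<close>.
  Below, the square root is \<open>gluing_root = 1 + x t gluing_h\<close>, and the numerator is
  \<open>t + x gluing_tail\<close>.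
\<close>

definition gluing_param :: "complex fps"
  where "gluing_param = (SOME f. f = 1 + 4 * fps_X ^ 3 * f ^ 3)"

lemma gluing_param_eq: "gluing_param = 1 + 4 * fps_X ^ 3 * gluing_param ^ 3"
proof -
  obtain f :: "complex fps" where "f = 1 + fps_X * (4 * fps_X\<^sup>2 * (f * (f * f)))"
  proof (rule fps_fixed_point)
    fix f g :: "complex fps" and n
    assume *: "\<And>i. i < n \<Longrightarrow> f $ i = g $ i"
    show "(1 + fps_X * (4 * fps_X\<^sup>2 * (f * (f * f)))) $ n = (1 + fps_X * (4 * fps_X\<^sup>2 * (g * (g * g)))) $ n"
      unfolding fps_add_nth
      by (intro arg_cong2[where f = "(+)"] refl fps_X_mult_agree fps_mult_agree[of n] *) auto
  qed
  hence "f = 1 + 4 * fps_X ^ 3 * f ^ 3"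
    by (simp add: eval_nat_numeral algebra_simps)
  thus ?thesis unfolding gluing_param_def by (rule someI)
qed

abbreviation xp :: "complex poly fps" where "xp \<equiv> fps_const [:0, 1:]"

text \<open>The equation is \<open>(1 + x t f)^2 = 1 - t v (v + 1) x + t^2 v^2 x^2\<close> after
  subtracting \<open>1\<close> and dividing by \<open>x t\<close>.\<close>

definition gluing_h :: "complex poly fps"
  where "gluing_h = (SOME f. 2 * f = - coef_fps gluing_param * (coef_fps gluing_param + 1) + fps_X * (coef_fps gluing_param)\<^sup>2 * xp - xp * fps_X * f\<^sup>2)"

lemma gluing_h_eq: "2 * gluing_h = - coef_fps gluing_param * (coef_fps gluing_param + 1) + fps_X * (coef_fps gluing_param)\<^sup>2 * xp - xp * fps_X * gluing_h\<^sup>2"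
proof -
  let ?h = "fps_const [:1 / 2:] :: complex poly fps"
  have h: "2 * (?h * F) = F" for F
  proof -
    have "2 * ?h = 1" by (simp add: numeral_fps_const numeral_poly pCons_one)
    thus ?thesis by (metis mult.assoc mult_1)
  qed
  obtain f :: "complex poly fps" where
    f: "f = ?h * (- coef_fps gluing_param * (coef_fps gluing_param + 1) + fps_X * (coef_fps gluing_param)\<^sup>2 * xp) - fps_X * (?h * xp * (f * f))"
  proof (rule fps_fixed_point)
    fix f g :: "complex poly fps" and n
    assume *: "\<And>i. i < n \<Longrightarrow> f $ i = g $ i"
    show "(?h * (- coef_fps gluing_param * (coef_fps gluing_param + 1) + fps_X * (coef_fps gluing_param)\<^sup>2 * xp) - fps_X * (?h * xp * (f * f))) $ n
      = (?h * (- coef_fps gluing_param * (coef_fps gluing_param + 1) + fps_X * (coef_fps gluing_param)\<^sup>2 * xp) - fps_X * (?h * xp * (g * g))) $ n"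
      unfolding fps_sub_nth
      by (intro arg_cong2[where f = "(-)"] refl fps_X_mult_agree fps_mult_agree[of n] *) auto
  qed
  have "2 * f = - coef_fps gluing_param * (coef_fps gluing_param + 1) + fps_X * (coef_fps gluing_param)\<^sup>2 * xp - xp * fps_X * f\<^sup>2"
    apply (subst f)
    unfolding right_diff_distrib mult.left_commute[of 2 fps_X] mult.assoc h
    by (simp add: power2_eq_square algebra_simps)
  thus ?thesis unfolding gluing_h_def by (rule someI)
qed

definition gluing_lead :: "complex poly poly fps"
  where "gluing_lead = 1 - 4 * fps_X ^ 3 * (embed_series gluing_param)\<^sup>2"

definition gluing_root :: "complex poly fps"
  where "gluing_root = 1 + xp * fps_X * gluing_h"

definition gluing_tail :: "complex poly fps"
  where "gluing_tail = fps_X\<^sup>2 * gluing_h + (2 * fps_X\<^sup>2 * coef_fps gluing_param - (1 - 4 * fps_X ^ 3 * (coef_fps gluing_param)\<^sup>2) * xp) * gluing_root"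

lemmas eval_simps = eval_fps_hom eval_fps_numeral eval_fps_const eval_fps_var eval_fps_coef_fps

lemma embed_series_numeral: "embed_series (numeral k) = numeral k"
  using eval_fps_coef_fps[of 0 "numeral k"]
proof (induction k)
  case (Bit0 k) thus ?case by (simp only: numeral_Bit0 embed_series_hom eval_fps_coef_fps)
next
  case (Bit1 k) thus ?case by (simp only: numeral_Bit1 embed_series_hom numeral_One eval_fps_coef_fps)
qed (simp only: numeral_One embed_series_hom)

lemma embed_series_gluing_param_eq: "embed_series gluing_param = 1 + 4 * fps_X ^ 3 * embed_series gluing_param ^ 3"
  by (subst gluing_param_eq) (simp only: embed_series_hom embed_series_numeral)

lemma embed_series_gluing_param_0: "embed_series gluing_param $ 0 = 1"
  by (subst embed_series_gluing_param_eq) (simp add: fps_mult_nth_0)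

lemma eval_gluing_h: "2 * eval_fps z gluing_h = - embed_series gluing_param * (embed_series gluing_param + 1) + fps_X * (embed_series gluing_param)\<^sup>2 * z - z * fps_X * (eval_fps z gluing_h)\<^sup>2"
  using arg_cong[OF gluing_h_eq, of "eval_fps z"] by (simp only: eval_simps)

lemma eval_gluing_h_0: "eval_fps z gluing_h $ 0 = - 1"
proof -
  have "2 * (eval_fps z gluing_h $ 0) = (2 * eval_fps z gluing_h) $ 0" by (simp add: numeral_fps_const)
  also have "\<dots> = -2"
    unfolding eval_gluing_h by (simp add: embed_series_gluing_param_0 fps_mult_nth_0 mult.assoc)
  finally have "2 * (eval_fps z gluing_h $ 0) = 2 * (- 1)" by simp
  thus ?thesis by (simp only: mult_cancel_left) simp
qed

lemma eval_gluing_root: "eval_fps z gluing_root = 1 + z * fps_X * eval_fps z gluing_h"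
  unfolding gluing_root_def by (simp only: eval_simps)

lemma eval_gluing_root_square:
  "(eval_fps z gluing_root)\<^sup>2 = 1 - fps_X * embed_series gluing_param * (embed_series gluing_param + 1) * z + fps_X\<^sup>2 * (embed_series gluing_param)\<^sup>2 * z\<^sup>2"
proof -
  have "(eval_fps z gluing_root)\<^sup>2 = 1 + z * fps_X * (2 * eval_fps z gluing_h) + z\<^sup>2 * fps_X\<^sup>2 * (eval_fps z gluing_h)\<^sup>2"
    unfolding eval_gluing_root by (simp add: power2_eq_square algebra_simps)
  thus ?thesis unfolding eval_gluing_h by (simp add: power2_eq_square algebra_simps)
qed

lemma eval_gluing_tail:
  "eval_fps z gluing_tail = fps_X\<^sup>2 * eval_fps z gluing_h + (2 * fps_X\<^sup>2 * embed_series gluing_param - gluing_lead * z) * eval_fps z gluing_root"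
  unfolding gluing_tail_def gluing_lead_def by (simp only: eval_simps)

lemma eval_gluing_num: "fps_X + z * eval_fps z gluing_tail = (fps_X + 2 * fps_X\<^sup>2 * embed_series gluing_param * z - gluing_lead * z\<^sup>2) * eval_fps z gluing_root"
  unfolding eval_gluing_tail eval_gluing_root by (simp add: power2_eq_square algebra_simps)

lemma two_times_half: "2 * [:[:1 / 2:]:] = (1 :: complex poly poly)"
proof -
  have "2 = ([:[:2:]:] :: complex poly poly)" by (simp add: numeral_poly)
  hence "2 * [:[:1 / 2:]:] = ([:[:2:]:] * [:[:1 / 2:]:] :: complex poly poly)" by (rule arg_cong)
  also have "\<dots> = 1" by (simp add: pCons_one)
  finally show ?thesis .
qed

lemma rk_kernel_nth_0: "rk_kernel fps_X xv yv $ 0 = [:0, [:0, 1:]:]"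
  by (simp add: rk_kernel_def xv_def yv_def)

text \<open>
  \<open>D(x)^2 = D(y)^2\<close> holds modulo the kernel because both are the same polynomial in \<open>I\<close>.  The sign
  is decided without substituting a branch of the kernel: after removal of \<open>x - y\<close>, the factor
  belonging to \<open>D(x) - D(y)\<close> is \<open>t\<close> times a unit modulo the kernel.
\<close>

lemma gluing_kernel:
  obtains E where "yv * (fps_X + xv * eval_fps xv gluing_tail) + xv * (fps_X + yv * eval_fps yv gluing_tail) = rk_kernel fps_X xv yv * E"
proof -
  let ?t = "fps_X :: complex poly poly fps" and ?K = "rk_kernel fps_X xv yv"
  define v where "v = embed_series gluing_param"
  define x y where "x = xv" and "y = yv"
  define Gx Gy hx where "Gx = eval_fps x gluing_root" and "Gy = eval_fps y gluing_root" and "hx = eval_fps x gluing_h"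
  define Px Py where "Px = ?t + 2 * ?t\<^sup>2 * v * x - gluing_lead * x\<^sup>2" and "Py = ?t + 2 * ?t\<^sup>2 * v * y - gluing_lead * y\<^sup>2"
  define e Z where "e = y * (Px * Gx) + x * (Py * Gy)"
    and "Z = y * invariant_num ?t x + x * invariant_num ?t y - ?t\<^sup>2 * v * (3 - v) * x * y"
  have xy: "x - y \<noteq> 0" by (simp add: x_def y_def xv_def yv_def)
  have Gx: "Gx = 1 + x * ?t * hx" unfolding Gx_def hx_def by (rule eval_gluing_root)
  have Gy: "Gy = 1 + y * ?t * eval_fps y gluing_h" unfolding Gy_def by (rule eval_gluing_root)
  \<comment> \<open>\<open>Gx + Gy\<close> has constant term \<open>2\<close> and is a unit, so
    divisibility of the difference of squares by \<open>(x - y) t\<close> passes to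
    \<open>Gx - Gy\<close>.\<close>
  have "(Gx + Gy) $ 0 * [:[:1 / 2:]:] = 1"
    using two_times_half unfolding Gx Gy by (simp add: fps_mult_nth_0 del: mult_pCons_right)
  then obtain U where U: "(Gx + Gy) * U = 1" by (rule fps_unitI)
  define D where "D = U * (- v * (v + 1) + ?t * v\<^sup>2 * (x + y))"
  have D: "Gx - Gy = (x - y) * ?t * D"
  proof -
    have "(Gx - Gy) * (Gx + Gy) = Gx\<^sup>2 - Gy\<^sup>2" by (simp add: power2_eq_square algebra_simps)
    also have "\<dots> = (x - y) * ?t * (- v * (v + 1) + ?t * v\<^sup>2 * (x + y))"
      unfolding Gx_def Gy_def eval_gluing_root_square v_def[symmetric]
      by (simp add: power2_eq_square algebra_simps)
    finally have "(Gx - Gy) * ((Gx + Gy) * U) = (x - y) * ?t * D"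
      unfolding D_def by (simp only: mult_ac)
    thus ?thesis unfolding U by simp
  qed
  define f where "f = - (?t + gluing_lead * x * y) * Gx + x * Py * ?t * D"
  have f: "y * (Px * Gx) - x * (Py * Gy) = (x - y) * f"
  proof -
    have "y * (Px * Gx) - x * (Py * Gy) = (y * Px - x * Py) * Gx + x * Py * (Gx - Gy)"
      by (simp add: algebra_simps)
    also have "y * Px - x * Py = - (x - y) * (?t + gluing_lead * x * y)"
      unfolding Px_def Py_def by (simp add: power2_eq_square algebra_simps)
    finally show ?thesis unfolding D f_def by (simp add: algebra_simps)
  qed
  have sq: "(Px * Gx)\<^sup>2 = (invariant_num ?t x)\<^sup>2 - ?t\<^sup>2 * v * (3 - v) * x * invariant_num ?t x
     + (?t ^ 4 * v\<^sup>2 - 4 * ?t ^ 4 * v ^ 3 - 2 * ?t * gluing_lead - 2 * ?t) * x\<^sup>2"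
    "(Py * Gy)\<^sup>2 = (invariant_num ?t y)\<^sup>2 - ?t\<^sup>2 * v * (3 - v) * y * invariant_num ?t y
     + (?t ^ 4 * v\<^sup>2 - 4 * ?t ^ 4 * v ^ 3 - 2 * ?t * gluing_lead - 2 * ?t) * y\<^sup>2"
    unfolding Px_def Py_def
    by (rule gluing_square, simp_all only: v_def gluing_lead_def Gx_def Gy_def eval_gluing_root_square, rule embed_series_gluing_param_eq)+
  \<comment> \<open>Both squares come from one quadratic polynomial in \<open>I\<close>, so their
    difference contains \<open>I(x) - I(y)\<close>, that is, \<open>x - y\<close> and the
    kernel.\<close>
  have "e * (y * (Px * Gx) - x * (Py * Gy)) = y\<^sup>2 * (Px * Gx)\<^sup>2 - x\<^sup>2 * (Py * Gy)\<^sup>2"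
    unfolding e_def by (simp add: power2_eq_square algebra_simps)
  also have "\<dots> = (y * invariant_num ?t x - x * invariant_num ?t y) * Z"
    unfolding sq Z_def by (simp add: power2_eq_square algebra_simps)
  also have "\<dots> = (x - y) * (- ?K * Z)"
    unfolding invariant_num_cong x_def y_def by (simp add: algebra_simps)
  finally have "(x - y) * (e * f) = (x - y) * (- ?K * Z)"
    unfolding f by (simp only: mult_ac)
  hence ef: "e * f = - ?K * Z" using xy by (metis mult_left_cancel)
  \<comment> \<open>The term \<open>x y\<close> of the kernel cancels the constant term
    \<open>- x y\<close> of \<open>f\<close>, which leaves a multiple of \<open>t\<close>.\<close>
  define V where "V = - 1 + 4 * ?t\<^sup>2 * v\<^sup>2 * x * y - (?t + gluing_lead * x * y) * x * hx + x * Py * D - (x\<^sup>2 * y + x * y\<^sup>2 + 1)"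
  have V: "f + ?K = ?t * V"
    unfolding f_def V_def Gx rk_kernel_def x_def[symmetric] y_def[symmetric] gluing_lead_def v_def[symmetric]
    by (simp add: power2_eq_square power3_eq_cube algebra_simps)
  have v0: "v $ 0 = 1" and m0: "gluing_lead $ 0 = 1"
    by (simp_all add: v_def embed_series_gluing_param_0 gluing_lead_def fps_mult_nth_0 mult.assoc)
  have "2 * U $ 0 = 1"
    using arg_cong[OF U, of "\<lambda>F. F $ 0"] unfolding Gx Gy by (simp add: fps_mult_nth_0)
  hence D0: "D $ 0 = - 1"
    unfolding D_def by (simp add: fps_mult_nth_0 v0 mult.commute)
  have hx0: "hx $ 0 = - 1" unfolding hx_def by (rule eval_gluing_h_0)
  have Py0: "Py $ 0 = - (y $ 0)\<^sup>2"
    unfolding Py_def by (simp add: fps_mult_nth_0 m0 mult.assoc power2_eq_square)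
  have "V $ 0 = - 2"
    unfolding V_def by (simp add: fps_mult_nth_0 D0 hx0 Py0 m0 mult.assoc power2_eq_square algebra_simps)
  hence "V $ 0 * - [:[:1 / 2:]:] = 1"
    using two_times_half by (simp del: mult_pCons_right minus_pCons)
  then obtain W where W: "V * W = 1" by (rule fps_unitI)
  \<comment> \<open>The constant term \<open>x y\<close> of the kernel is nonzero, so
    \<open>t\<close> divides \<open>e - Z\<close> and can be cancelled.\<close>
  have tVe: "?t * (V * e) = ?K * (e - Z)"
  proof -
    have "?t * (V * e) = e * (f + ?K)" unfolding V by (simp add: mult_ac)
    thus ?thesis using ef by (simp add: algebra_simps)
  qed
  have "(?K * (e - Z)) $ 0 = 0" unfolding tVe[symmetric] by simp
  hence "(e - Z) $ 0 = 0" by (simp add: rk_kernel_nth_0 fps_mult_nth_0)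
  then obtain Z' where "e - Z = ?t * Z'" using fps_X_dvdI by blast
  with tVe have "?t * (V * e) = ?t * (?K * Z')" by (simp add: mult_ac)
  hence "V * e = ?K * Z'" by simp
  hence "e = ?K * (Z' * W)" using W by (metis mult.assoc mult.commute mult_1)
  thus thesis
    unfolding e_def Px_def Py_def v_def Gx_def Gy_def x_def y_def eval_gluing_num[symmetric] by (rule that)
qed

section \<open>Decoupling\<close>

lemma rk_kernel_commute: "rk_kernel t x y = rk_kernel t y x"
  by (simp add: rk_kernel_def algebra_simps)

lemma cst_eq_0_iff [simp]: "cst r = 0 \<longleftrightarrow> r = 0"
  by (simp add: cst_def)

lemma cst_nth_0: "cst r $ 0 = [:[:r:]:]"
  by (simp add: cst_def)

lemma axis_factor_nonzero:
  assumes "z \<noteq> 0 \<or> a \<noteq> 1"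
  shows "axis_factor (cst a) fps_X z \<noteq> 0"
proof (cases "a = 1")
  case True
  thus ?thesis using assms by (simp add: axis_factor_def)
next
  case False
  have "axis_factor (cst a) fps_X z = cst (a - 1) - cst a * fps_X * z"
    by (simp add: axis_factor_def cst_diff)
  hence "axis_factor (cst a) fps_X z $ 0 = [:[:a - 1:]:]"
    by (simp add: cst_nth_0 fps_mult_nth_0)
  thus ?thesis using False by auto
qed

text \<open>The division is done before any evaluation, so that one \<open>C\<close> serves all
  \<open>z\<close>. For \<open>a \<noteq> 1\<close> the divisor is a unit; for \<open>a = 1\<close>
  the two factors have quotient \<open>t^2\<close>.\<close>

lemma axis_factor_quotient:
  obtains C where "\<And>z. axis_factor (cst a) fps_X z * eval_fps z C = axis_factor_norm (cst a) fps_X z * eval_fps z A"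
proof (cases "a = 1")
  case True
  have "axis_factor (cst a) fps_X z * eval_fps z (fps_X\<^sup>2 * A) = axis_factor_norm (cst a) fps_X z * eval_fps z A" for z
    unfolding True axis_factor_def axis_factor_norm_def by (simp only: eval_simps cst_1) (simp add: eval_nat_numeral)
  thus thesis by (rule that)
next
  case False
  let ?l = "axis_factor (fps_const [:a:]) fps_X xp" and ?n = "axis_factor_norm (fps_const [:a:]) fps_X xp"
  have ev: "eval_fps z ?l = axis_factor (cst a) fps_X z" "eval_fps z ?n = axis_factor_norm (cst a) fps_X z" for z
    unfolding axis_factor_def axis_factor_norm_def invariant_num_def by (simp_all only: eval_simps)
  have "[:a - 1:] = [:a:] - [:1:]" by simp
  hence "?l $ 0 = [:a - 1:]"
    by (simp add: axis_factor_def pCons_one fps_mult_nth_0)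
  moreover have "[:a - 1:] * [:1 / (a - 1):] = 1"
    using False by (simp add: pCons_one)
  ultimately have "?l $ 0 * [:1 / (a - 1):] = 1" by simp
  then obtain J where J: "?l * J = 1" by (rule fps_unitI)
  have "axis_factor (cst a) fps_X z * eval_fps z (J * ?n * A) = axis_factor_norm (cst a) fps_X z * eval_fps z A" for z
  proof -
    have "?l * (J * ?n * A) = (?l * J) * (?n * A)" by (simp only: mult_ac)
    hence "eval_fps z (?l * (J * ?n * A)) = eval_fps z (?n * A)" by (simp only: J mult_1_left)
    thus ?thesis by (simp only: eval_simps(2) ev)
  qed
  thus thesis by (rule that)
qed

text \<open>Multiplication by \<open>axis_factor\<close> at \<open>x\<close> reduces this to the
  norm formula. In the application \<open>C\<close> is a series in \<open>x\<close> alone, which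
  separates the variables.\<close>

lemma axis_factor_quotient_decouple:
  fixes x y :: "complex poly poly fps"
  assumes C: "axis_factor (cst a) fps_X x * C = axis_factor_norm (cst a) fps_X x * A" and "x \<noteq> 0"
  shows "((cst a - 1) * x * y - cst a * fps_X) * axis_factor (cst a) fps_X y * (x * A)
    = x * y * C + cst a * (cst a - 1) * rk_kernel fps_X x y * (x * A)"
proof -
  let ?l = "axis_factor (cst a) fps_X x"
  have "?l * (((cst a - 1) * x * y - cst a * fps_X) * axis_factor (cst a) fps_X y * (x * A))
    = (((cst a - 1) * x * y - cst a * fps_X) * ?l * axis_factor (cst a) fps_X y) * (x * A)"
    by (simp only: mult_ac)
  also have "\<dots> = x * y * (axis_factor_norm (cst a) fps_X x * A) + ?l * (cst a * (cst a - 1) * rk_kernel fps_X x y * (x * A))"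
    unfolding axis_factor_norm_eq by (simp only: algebra_simps)
  also have "\<dots> = ?l * (x * y * C + cst a * (cst a - 1) * rk_kernel fps_X x y * (x * A))"
    unfolding C[symmetric] by (simp only: algebra_simps)
  finally show ?thesis using axis_factor_nonzero[of x a] assms(2) by (metis mult_left_cancel)
qed

section \<open>Sums of a series in x and a series in y\<close>

text \<open>A multiple of \<open>x y\<close> has no pure power of \<open>x\<close> or
  \<open>y\<close> and no constant term, whereas the sum has nothing else; only the constants can
  cancel.\<close>

lemma univariate_sum_divisible:
  fixes p r :: "complex poly"
  assumes "[:p:] + map_poly (\<lambda>r. [:r:]) r = [:0, [:0, 1:]:] * m"
  obtains s where "p = [:s:]" "r = [:- s:]"
proof -
  have eq: "(if j = 0 then poly.coeff p i else 0) + (if i = 0 then poly.coeff r j else 0)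
    = (if i = 0 \<or> j = 0 then 0 else poly.coeff (poly.coeff m (j - 1)) (i - 1))" for i j
  proof -
    have "poly.coeff (poly.coeff ([:p:] + map_poly (\<lambda>r. [:r:]) r) j) i
      = poly.coeff (poly.coeff ([:0, [:0, 1:]:] * m) j) i"
      using assms by simp
    thus ?thesis by (simp add: coeff_map_poly coeff_pCons split: nat.splits)
  qed
  have "p = [:poly.coeff p 0:]"
  proof (rule poly_eqI)
    fix i show "poly.coeff p i = poly.coeff [:poly.coeff p 0:] i"
      using eq[of 0 i] by (cases i) (auto simp: coeff_pCons)
  qed
  moreover have "r = [:- poly.coeff p 0:]"
  proof (rule poly_eqI)
    fix i show "poly.coeff r i = poly.coeff [:- poly.coeff p 0:] i"
      using eq[of i 0] by (cases i) (auto simp: coeff_pCons eq_neg_iff_add_eq_0 add.commute)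
  qed
  ultimately show thesis by (rule that)
qed

text \<open>
  Modulo \<open>t\<close> the kernel is \<open>x y\<close>, which divides no nonzero sum of a function of \<open>x\<close> and a function
  of \<open>y\<close>; apply this to the lowest coefficient of the cofactor.
\<close>

lemma decoupled_sum_constant:
  assumes eq: "xv * yv * (eval_fps xv U + eval_fps yv V) = rk_kernel fps_X xv yv * G"
  obtains q where "U = coef_fps q" "V = - coef_fps q"
proof -
  let ?t = "fps_X :: complex poly poly fps" and ?s = "eval_fps xv U + eval_fps yv V"
  define L where "L = xv\<^sup>2 * yv + xv * yv\<^sup>2 + 1"
  have K: "rk_kernel ?t xv yv = xv * yv - ?t * L" by (simp add: rk_kernel_def L_def)
  have xy: "(xv * yv) $ 0 = [:0, [:0, 1:]:]" "xv * yv \<noteq> 0" by (simp_all add: xv_def yv_def)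
  \<comment> \<open>As the kernel is \<open>x y (1 - t x - t y) - t\<close>, the hypothesis becomes
    \<open>x y M = t G\<close>; hence \<open>x y\<close> divides \<open>G\<close> and can be
    cancelled.\<close>
  define M where "M = (1 - ?t * xv - ?t * yv) * G - ?s"
  have "xv * yv * M = ?t * G"
    unfolding M_def right_diff_distrib eq rk_kernel_def by (simp add: algebra_simps power2_eq_square)
  moreover from this have "(xv * yv) $ 0 * M $ 0 = 0"
    by (metis fps_mult_nth_0 fps_X_nth mult_zero_left zero_neq_one)
  hence "M $ 0 = 0" unfolding xy(1) by (simp only: mult_eq_0_iff) simp
  then obtain M' where "M = ?t * M'" using fps_X_dvdI by blast
  ultimately have "?t * (xv * yv * M') = ?t * G" by (simp only: mult_ac)
  hence "G = xv * yv * M'" by (simp only: mult_cancel_left) simp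
  hence "xv * yv * ?s = xv * yv * (rk_kernel ?t xv yv * M')" using eq by (simp only: mult_ac)
  hence s: "?s = rk_kernel ?t xv yv * M'" using xy(2) by (metis mult_left_cancel)
  have s_nth: "?s $ n = [:U $ n:] + map_poly (\<lambda>r. [:r:]) (V $ n)" for n
    by (simp add: eval_fps_xv_nth eval_fps_yv_nth)
  \<comment> \<open>If \<open>M'\<close> vanishes below \<open>n\<close>, coefficient
    \<open>n\<close> of the sum is \<open>x y\<close> times that of \<open>M'\<close>, which forces
    it to be \<open>0\<close>.\<close>
  have M': "M' $ n = 0" for n
  proof (induction n rule: less_induct)
    case (less n)
    have "(?t * (L * M')) $ n = (?t * (L * 0)) $ n"
      by (rule fps_X_mult_agree, rule fps_mult_agree[of n]) (simp_all add: less)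
    moreover have "(xv * yv * M') $ n = [:0, [:0, 1:]:] * M' $ n"
      by (simp add: xv_def yv_def)
    ultimately have n: "?s $ n = [:0, [:0, 1:]:] * M' $ n"
      unfolding s K by (simp add: left_diff_distrib mult.assoc)
    then obtain r where "U $ n = [:r:]" "V $ n = [:- r:]"
      unfolding s_nth by (rule univariate_sum_divisible)
    hence "[:0, [:0, 1:]:] * M' $ n = 0"
      unfolding n[symmetric] s_nth by (simp add: map_poly_pCons)
    thus ?case by (simp only: mult_eq_0_iff) simp
  qed
  have "\<exists>r. U $ n = [:r:] \<and> V $ n = [:- r:]" for n
  proof -
    have "M' = 0" using M' by (intro fps_ext) simp
    hence "[:U $ n:] + map_poly (\<lambda>r. [:r:]) (V $ n) = [:0, [:0, 1:]:] * 0"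
      unfolding s_nth[symmetric] s by simp
    thus ?thesis by (rule univariate_sum_divisible) blast
  qed
  then obtain q where q: "\<And>n. U $ n = [:q n:]" "\<And>n. V $ n = [:- q n:]" by metis
  show thesis
    by (rule that[of "Abs_fps q"]) (auto intro!: fps_ext simp: coef_fps_def q)
qed

text \<open>
  The coefficients of \<open>\<mu>\<close> and \<open>\<nu>\<close> in the decoupled equations, doubled to avoid halves; \<open>T\<close> stands for
  the value of \<open>gluing_tail\<close>.
\<close>

definition mu_coeff_x where "mu_coeff_x t a b T z = - 2 * (a - 1) * (b - 1) + 2 * (a - 1) * b * t * z - t * a * b * T + t * a * b * (t * z\<^sup>2 - z)"
definition nu_coeff_x where "nu_coeff_x t a b T z = 2 * (a - 1) * (b - 1) + 2 * a * b * t ^ 3 - 2 * (a - 1) * (b - 1) * t * z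
  + t * (2 * a * b - a - b) * T + t * (a - b) * (t * z\<^sup>2 - z)"
definition mu_coeff_y where "mu_coeff_y t a b T z = 2 * a * (b - 1) * t * z - t * a * b * T + t * a * b * (t * z\<^sup>2 - z)"
definition nu_coeff_y where "nu_coeff_y t a b T z = - 2 * (a - 1) * (b - 1) * t * z
  + t * (2 * a * b - a - b) * T - t * (a - b) * (t * z\<^sup>2 - z)"

text \<open>The last two equations are identities between series in one variable, so they hold at
  every \<open>z\<close>, not only at \<open>xv\<close> and \<open>yv\<close>; this permits
  evaluation at roots.\<close>

theorem decoupled_equations:
  fixes a b c :: complex
  defines "t \<equiv> fps_X :: complex poly poly fps"
  obtains A B C C' u q where
    "rk_kernel t xv yv * walk_gf reverse_kreweras a b c =
      ((cst a - 1) * xv * yv - cst a * t) * (xv * eval_fps xv A)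
      + ((cst b - 1) * xv * yv - cst b * t) * (yv * eval_fps yv B)
      + xv * yv * (1 + (cst c - 1) * embed_series u) - t * (1 + cst c * embed_series u)"
    and "\<And>z. axis_factor (cst a) t z * eval_fps z C = axis_factor_norm (cst a) t z * eval_fps z A"
    and "\<And>z. axis_factor (cst b) t z * eval_fps z C' = axis_factor_norm (cst b) t z * eval_fps z B"
    and "\<And>z. 2 * axis_factor (cst b) t z * eval_fps z C = embed_series q
      + (1 + (cst c - 1) * embed_series u) * mu_coeff_x t (cst a) (cst b) (eval_fps z gluing_tail) z
      + (1 + cst c * embed_series u) * nu_coeff_x t (cst a) (cst b) (eval_fps z gluing_tail) z"
    and "\<And>z. 2 * axis_factor (cst a) t z * eval_fps z C' = - embed_series q
      + (1 + (cst c - 1) * embed_series u) * mu_coeff_y t (cst a) (cst b) (eval_fps z gluing_tail) z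
      + (1 + cst c * embed_series u) * nu_coeff_y t (cst a) (cst b) (eval_fps z gluing_tail) z"
proof -
  obtain A B u where FE: "rk_kernel t xv yv * walk_gf reverse_kreweras a b c =
      ((cst a - 1) * xv * yv - cst a * t) * (xv * eval_fps xv A)
      + ((cst b - 1) * xv * yv - cst b * t) * (yv * eval_fps yv B)
      + xv * yv * (1 + (cst c - 1) * embed_series u) - t * (1 + cst c * embed_series u)"
    unfolding t_def by (rule functional_equation)
  obtain C where C: "\<And>z. axis_factor (cst a) t z * eval_fps z C = axis_factor_norm (cst a) t z * eval_fps z A"
    unfolding t_def using axis_factor_quotient[of a A] by blast
  obtain C' where C': "\<And>z. axis_factor (cst b) t z * eval_fps z C' = axis_factor_norm (cst b) t z * eval_fps z B"
    unfolding t_def using axis_factor_quotient[of b B] by blast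
  obtain E where E: "yv * (t + xv * eval_fps xv gluing_tail) + xv * (t + yv * eval_fps yv gluing_tail) = rk_kernel t xv yv * E"
    unfolding t_def by (rule gluing_kernel)
  have nz: "xv \<noteq> 0" "yv \<noteq> 0" by (simp_all add: xv_def yv_def)
  note Cx = axis_factor_quotient_decouple[OF C[unfolded t_def] nz(1), where y = yv, folded t_def]
  note Cy' = axis_factor_quotient_decouple[OF C'[unfolded t_def] nz(2), where y = xv, folded t_def]
  have Cy: "((cst b - 1) * xv * yv - cst b * t) * axis_factor (cst b) t xv * (yv * eval_fps yv B)
    = xv * yv * eval_fps yv C' + cst b * (cst b - 1) * rk_kernel t xv yv * (yv * eval_fps yv B)"
    using Cy' unfolding rk_kernel_commute[of t yv xv] by (simp only: mult_ac)
  let ?a = "fps_const [:a:]" and ?b = "fps_const [:b:]" and ?c = "fps_const [:c:]" and ?u = "coef_fps u"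
  let ?m = "1 + (?c - 1) * ?u" and ?n = "1 + ?c * ?u"
  define U where "U = 2 * axis_factor ?b fps_X xp * C - ?m * mu_coeff_x fps_X ?a ?b gluing_tail xp - ?n * nu_coeff_x fps_X ?a ?b gluing_tail xp"
  define V where "V = 2 * axis_factor ?a fps_X xp * C' - ?m * mu_coeff_y fps_X ?a ?b gluing_tail xp - ?n * nu_coeff_y fps_X ?a ?b gluing_tail xp"
  have evU: "eval_fps z U = 2 * axis_factor (cst b) t z * eval_fps z C
      - (1 + (cst c - 1) * embed_series u) * mu_coeff_x t (cst a) (cst b) (eval_fps z gluing_tail) z
      - (1 + cst c * embed_series u) * nu_coeff_x t (cst a) (cst b) (eval_fps z gluing_tail) z" for z
    unfolding U_def mu_coeff_x_def nu_coeff_x_def axis_factor_def t_def by (simp only: eval_simps)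
  have evV: "eval_fps z V = 2 * axis_factor (cst a) t z * eval_fps z C'
      - (1 + (cst c - 1) * embed_series u) * mu_coeff_y t (cst a) (cst b) (eval_fps z gluing_tail) z
      - (1 + cst c * embed_series u) * nu_coeff_y t (cst a) (cst b) (eval_fps z gluing_tail) z" for z
    unfolding V_def mu_coeff_y_def nu_coeff_y_def axis_factor_def t_def by (simp only: eval_simps)
  define \<mu> \<nu> where "\<mu> = 1 + (cst c - 1) * embed_series u" and "\<nu> = 1 + cst c * embed_series u"
  note dec = decouple[OF FE[folded \<mu>_def \<nu>_def] Cx Cy E refl refl refl]
  have sum: "eval_fps xv U + eval_fps yv V =
      (2 * axis_factor (cst b) t xv * eval_fps xv C + 2 * ((cst a - 1) * (cst b - 1) * (\<mu> - \<nu>) - \<nu> * cst a * cst b * t ^ 3)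
            + 2 * (\<nu> * (cst a - 1) * (cst b - 1) - \<mu> * (cst a - 1) * cst b) * t * xv
            - t * (\<nu> * (2 * cst a * cst b - cst a - cst b) - \<mu> * cst a * cst b) * eval_fps xv gluing_tail
            - t * (\<mu> * cst a * cst b + \<nu> * (cst a - cst b)) * (t * xv\<^sup>2 - xv))
         + (2 * axis_factor (cst a) t yv * eval_fps yv C'
            + 2 * (\<nu> * (cst a - 1) * (cst b - 1) - \<mu> * cst a * (cst b - 1)) * t * yv
            - t * (\<nu> * (2 * cst a * cst b - cst a - cst b) - \<mu> * cst a * cst b) * eval_fps yv gluing_tail
            - t * (\<mu> * cst a * cst b - \<nu> * (cst a - cst b)) * (t * yv\<^sup>2 - yv))"
    unfolding evU evV \<mu>_def[symmetric] \<nu>_def[symmetric] mu_coeff_x_def nu_coeff_x_def mu_coeff_y_def nu_coeff_y_def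
    by (simp add: algebra_simps)
  obtain q where q: "U = coef_fps q" "V = - coef_fps q"
    using dec[folded sum] unfolding t_def by (rule decoupled_sum_constant)
  have ev_q: "eval_fps z U = embed_series q" "eval_fps z V = - embed_series q" for z
    unfolding q by (simp_all only: eval_simps)
  have solve: "L = Q + M + N" if "e = L - M - N" "e = Q" for e L M N Q :: "complex poly poly fps"
    using that by (metis diff_add_cancel diff_diff_eq add.assoc add.commute)
  show thesis
    by (rule that[OF FE C C' solve[OF evU ev_q(1)] solve[OF evV ev_q(2)]])
qed

section \<open>Algebraicity of the walk series\<close>

lemma algebraic_cst [intro]: "algebraic_fps (cst r)"
  by (auto simp: cst_def)

lemma algebraic_gluing_param [intro]: "algebraic_fps (embed_series gluing_param)"
proof (rule algebraic_fps_cubic_root)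
  show "fps_of_poly 1 + fps_of_poly (- 1) * embed_series gluing_param + fps_of_poly 0 * (embed_series gluing_param)\<^sup>2
    + fps_of_poly (Polynomial.monom 4 3) * embed_series gluing_param ^ 3 = 0"
  proof -
    have "1 + 4 * fps_X ^ 3 * embed_series gluing_param ^ 3 - embed_series gluing_param = 0"
      using embed_series_gluing_param_eq by (metis eq_iff_diff_eq_0)
    moreover have "fps_of_poly (Polynomial.monom 4 3) = 4 * (fps_X :: complex poly poly fps) ^ 3"
      by (simp add: fps_of_poly_monom numeral_fps_const)
    moreover have "1 + (- 1) * embed_series gluing_param + 0 * (embed_series gluing_param)\<^sup>2 + 4 * fps_X ^ 3 * embed_series gluing_param ^ 3
        = 1 + 4 * fps_X ^ 3 * embed_series gluing_param ^ 3 - embed_series gluing_param"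
      by (simp add: algebra_simps)
    ultimately show ?thesis by (simp only: fps_of_poly_uminus fps_of_poly_1 fps_of_poly_0)
  qed
qed simp

lemmas algebraic_intros = algebraic_fps_add algebraic_fps_diff algebraic_fps_mult algebraic_fps_power
  algebraic_fps_uminus algebraic_fps_numeral algebraic_fps_X algebraic_cst algebraic_gluing_param

lemma algebraic_gluing_lead: "algebraic_fps gluing_lead"
  unfolding gluing_lead_def by (intro algebraic_intros)

lemma algebraic_gluing_root:
  assumes "algebraic_fps z"
  shows "algebraic_fps (eval_fps z gluing_root)"
  by (rule algebraic_fps_sqrt, unfold eval_gluing_root_square) (intro algebraic_intros assms)

text \<open>The square root minus \<open>1\<close> is \<open>z t\<close> times this value, so it is
  found by division; at \<open>z = 0\<close> the equation of \<open>gluing_h\<close> is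
  linear.\<close>

lemma algebraic_gluing_h:
  assumes "algebraic_fps z"
  shows "algebraic_fps (eval_fps z gluing_h)"
proof (cases "z = 0")
  case True
  have "algebraic_fps (2 * eval_fps z gluing_h)"
    unfolding eval_gluing_h unfolding True mult_zero_left mult_zero_right by (intro algebraic_intros)
  from algebraic_fps_divide[OF refl _ _ this] show ?thesis
    using algebraic_fps_numeral by simp
next
  case False
  have "algebraic_fps (z * fps_X * eval_fps z gluing_h)"
  proof -
    have "z * fps_X * eval_fps z gluing_h = eval_fps z gluing_root - 1" by (simp add: eval_gluing_root)
    thus ?thesis by (simp only:) (intro algebraic_intros algebraic_gluing_root assms)
  qed
  from algebraic_fps_divide[OF refl _ _ this] show ?thesis
    using False by (simp add: algebraic_intros assms)
qed

lemma algebraic_gluing_tail: "algebraic_fps z \<Longrightarrow> algebraic_fps (eval_fps z gluing_tail)"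
  unfolding eval_gluing_tail by (intro algebraic_intros algebraic_gluing_root algebraic_gluing_h algebraic_gluing_lead)

lemma algebraic_axis_factor: "algebraic_fps z \<Longrightarrow> algebraic_fps (axis_factor (cst a) fps_X z)"
  unfolding axis_factor_def by (intro algebraic_intros)

lemma algebraic_axis_factor_norm: "algebraic_fps z \<Longrightarrow> algebraic_fps (axis_factor_norm (cst a) fps_X z)"
  unfolding axis_factor_norm_def invariant_num_def by (intro algebraic_intros)

lemma algebraic_coeffs:
  assumes "algebraic_fps z" "algebraic_fps T"
  shows "algebraic_fps (mu_coeff_x fps_X (cst a) (cst b) T z)" "algebraic_fps (nu_coeff_x fps_X (cst a) (cst b) T z)"
    "algebraic_fps (mu_coeff_y fps_X (cst a) (cst b) T z)" "algebraic_fps (nu_coeff_y fps_X (cst a) (cst b) T z)"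
  unfolding mu_coeff_x_def nu_coeff_x_def mu_coeff_y_def nu_coeff_y_def by (intro algebraic_intros assms)+

section \<open>Small roots and linear equations\<close>

text \<open>Solving for the term \<open>(a - 1)^2 z\<close> exhibits the root as a fixed point,
  because all other terms of the norm carry a factor \<open>t\<close>.\<close>

lemma axis_factor_norm_root:
  assumes "a \<noteq> 1"
  obtains z where "z $ 0 = 0" "axis_factor_norm (cst a) fps_X z = 0" "algebraic_fps z"
proof -
  let ?t = "fps_X :: complex fps" and ?a = "fps_const a" and ?i = "fps_const (1 / (a - 1)\<^sup>2)"
  obtain r where r: "r = ?t * (- ?i * ((?a - 1) * ?a\<^sup>2 * (?t * (r * (r * r)) - r * r - ?t) + ?a ^ 3 * ?t\<^sup>2 * r))"
  proof (rule fps_fixed_point)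
    fix f g :: "complex fps" and n
    assume *: "\<And>i. i < n \<Longrightarrow> f $ i = g $ i"
    have sub: "(F - H) $ i = (F' - H') $ i" if "F $ i = F' $ i" "H $ i = H' $ i" for F F' H H' :: "complex fps" and i
      using that by simp
    have add: "(F + H) $ i = (F' + H') $ i" if "F $ i = F' $ i" "H $ i = H' $ i" for F F' H H' :: "complex fps" and i
      using that by simp
    show "(?t * (- ?i * ((?a - 1) * ?a\<^sup>2 * (?t * (f * (f * f)) - f * f - ?t) + ?a ^ 3 * ?t\<^sup>2 * f))) $ n
      = (?t * (- ?i * ((?a - 1) * ?a\<^sup>2 * (?t * (g * (g * g)) - g * g - ?t) + ?a ^ 3 * ?t\<^sup>2 * g))) $ n"
      by (rule fps_X_mult_agree) (intro fps_mult_agree[of n] sub add refl *; assumption)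
  qed
  have "?i * (?a - 1)\<^sup>2 = 1"
  proof -
    have "?i * (?a - 1)\<^sup>2 = fps_const (1 / (a - 1)\<^sup>2 * (a - 1)\<^sup>2)"
      by (simp only: fps_const_mult[symmetric] fps_const_power[symmetric] fps_const_sub[symmetric] fps_const_1_eq_1)
    thus ?thesis using assms by simp
  qed
  moreover define e where "e = (?a - 1) * ?a\<^sup>2 * (?t * (r * (r * r)) - r * r - ?t) + ?a ^ 3 * ?t\<^sup>2 * r"
  have "(?a - 1)\<^sup>2 * r = (?a - 1)\<^sup>2 * (?t * (- ?i * e))"
    using r unfolding e_def by (rule arg_cong)
  hence "(?a - 1)\<^sup>2 * r = - (?i * (?a - 1)\<^sup>2) * (?t * e)" by (simp only: mult_ac mult_minus_left mult_minus_right)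
  ultimately have "(?a - 1)\<^sup>2 * r = - (?t * e)" by simp
  hence "axis_factor_norm ?a ?t r = 0"
    unfolding axis_factor_norm_def invariant_num_def e_def by (simp add: eval_nat_numeral algebra_simps)
  moreover have ea: "embed_series ?a = cst a"
    by (simp add: embed_series_def cst.ext_const)
  have "embed_series (axis_factor_norm ?a ?t r) = axis_factor_norm (cst a) fps_X (embed_series r)"
    unfolding axis_factor_norm_def invariant_num_def by (simp only: embed_series_hom embed_series_numeral ea)
  ultimately have root: "axis_factor_norm (cst a) fps_X (embed_series r) = 0" by (simp add: embed_series_hom)
  have "r $ 0 = 0" by (subst r) simp
  hence "embed_series r $ 0 = 0" by (simp add: embed_series_nth)
  moreover have "algebraic_fps (embed_series r)"
  proof (rule algebraic_fps_cubic_root)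
    let ?c = "[:[:[:a:]:]:] :: complex poly poly poly" and ?T = "Polynomial.monom 1 1 :: complex poly poly poly"
    have conv: "fps_of_poly ?c = cst a" "fps_of_poly ?T = fps_X"
      by (simp_all add: fps_of_poly_const cst_def fps_of_poly_monom)
    show "fps_of_poly ((?c - 1) * ?c\<^sup>2 * ?T\<^sup>2) + fps_of_poly (- (?c - 1)\<^sup>2 - ?c ^ 3 * ?T ^ 3) * embed_series r
      + fps_of_poly ((?c - 1) * ?c\<^sup>2 * ?T) * (embed_series r)\<^sup>2 + fps_of_poly (- (?c - 1) * ?c\<^sup>2 * ?T\<^sup>2) * embed_series r ^ 3 = 0"
      using root unfolding axis_factor_norm_def invariant_num_def
      by (simp only: fps_of_poly_mult fps_of_poly_diff fps_of_poly_uminus fps_of_poly_power fps_of_poly_1 conv)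
        (simp add: algebra_simps eval_nat_numeral)
    \<comment> \<open>At \<open>t = 0\<close> the linear coefficient of the cubic is
      \<open>- (a - 1)^2\<close>, so the cubic is not the zero polynomial.\<close>
    have "poly (- (?c - 1)\<^sup>2 - ?c ^ 3 * ?T ^ 3) 0 = - ([:[:a:]:] - 1)\<^sup>2"
      by (simp add: poly_monom)
    moreover have "[:[:a:]:] - 1 \<noteq> (0 :: complex poly poly)"
    proof -
      have "[:[:a:]:] - 1 = ([:[:a - 1:]:] :: complex poly poly)"
        by (metis (no_types) diff_pCons diff_0 pCons_one minus_zero neg_equal_zero pCons_0_0 diff_self)
      thus ?thesis using assms by simp
    qed
    ultimately show "- (?c - 1)\<^sup>2 - ?c ^ 3 * ?T ^ 3 \<noteq> 0" by (metis neg_equal_0_iff_equal poly_0 power_eq_0_iff)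
  qed
  ultimately show thesis using root that by blast
qed

lemma quotient_root:
  assumes "axis_factor (cst a) fps_X z * C = axis_factor_norm (cst a) fps_X z * A"
    and "axis_factor_norm (cst a) fps_X z = 0" "a \<noteq> 1"
  shows "C = 0"
  using assms axis_factor_nonzero[of z a] by simp

text \<open>The coefficient of \<open>u\<close> is \<open>(c - 1) m + c n\<close>, and its constant
  term shows that it is nonzero.\<close>

lemma algebraic_from_linear:
  assumes eq: "(1 + (cst c - 1) * u) * m + (1 + cst c * u) * n = 0"
    and m: "algebraic_fps m" "m $ 0 = [:[:m0:]:]" and n: "algebraic_fps n" "n $ 0 = [:[:n0:]:]"
    and nz: "(c - 1) * m0 + c * n0 \<noteq> 0"
  shows "algebraic_fps u"
proof -
  let ?d = "cst (c - 1) * m + cst c * n"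
  have "?d $ 0 = [:[:(c - 1) * m0 + c * n0:]:]"
    by (simp add: fps_mult_nth_0 cst_nth_0 m n)
  hence d: "?d \<noteq> 0" using nz by (metis fps_zero_nth pCons_eq_0_iff)
  have "?d * u = - (m + n)"
    using eq by (simp add: cst_diff algebra_simps eq_neg_iff_add_eq_0)
  from this d show ?thesis
    by (rule algebraic_fps_divide) (intro algebraic_intros m(1) n(1))+
qed

text \<open>
  For \<open>b = 1\<close> the first linear equation comes from \<open>x = 0\<close>, and the second from the equation divided
  by \<open>x\<close>, since the root of \<open>axis_factor_norm\<close> is itself \<open>0\<close> when \<open>a = 0\<close>.  This requires the next
  divided difference of \<open>gluing_tail\<close>.
\<close>

definition gluing_tail2 :: "complex poly fps"
  where "gluing_tail2 = fps_X ^ 3 * ((coef_fps gluing_param)\<^sup>2 - gluing_h\<^sup>2) + 4 * fps_X ^ 3 * coef_fps gluing_param * gluing_h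
    - 2 * (1 - 4 * fps_X ^ 3 * (coef_fps gluing_param)\<^sup>2) * gluing_root"

lemma eval_gluing_tail2: "eval_fps z gluing_tail2 = fps_X ^ 3 * ((embed_series gluing_param)\<^sup>2 - (eval_fps z gluing_h)\<^sup>2)
    + 4 * fps_X ^ 3 * embed_series gluing_param * eval_fps z gluing_h - 2 * gluing_lead * eval_fps z gluing_root"
  unfolding gluing_tail2_def gluing_lead_def by (simp only: eval_simps)

lemma algebraic_gluing_tail2: "algebraic_fps z \<Longrightarrow> algebraic_fps (eval_fps z gluing_tail2)"
  unfolding eval_gluing_tail2 by (intro algebraic_intros algebraic_gluing_root algebraic_gluing_h algebraic_gluing_lead)

lemma gluing_lead_0: "gluing_lead $ 0 = 1"
  by (simp add: gluing_lead_def mult.assoc fps_mult_nth_0)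

lemma eval_gluing_tail2_0: "eval_fps z gluing_tail2 $ 0 = - 2"
  unfolding eval_gluing_tail2 eval_gluing_root by (simp add: fps_mult_nth_0 gluing_lead_0 mult.assoc)

lemma eval_gluing_tail_gluing_tail2:
  "2 * eval_fps z gluing_tail = fps_X\<^sup>2 * (3 * embed_series gluing_param - (embed_series gluing_param)\<^sup>2) + z * eval_fps z gluing_tail2"
proof -
  have "2 * eval_fps z gluing_tail = fps_X\<^sup>2 * (2 * eval_fps z gluing_h) + 2 * (2 * fps_X\<^sup>2 * embed_series gluing_param - gluing_lead * z) * eval_fps z gluing_root"
    unfolding eval_gluing_tail by (simp only: algebra_simps)
  thus ?thesis unfolding eval_gluing_h eval_gluing_tail2 eval_gluing_root
    by (simp add: eval_nat_numeral algebra_simps)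
qed

lemma algebraic_one_weight:
  fixes a c :: complex and u :: "complex poly poly fps"
  defines "M \<equiv> \<lambda>z. 4 * (cst a - 1) - cst a * eval_fps z gluing_tail2 + 2 * cst a * (fps_X * z - 1)"
    and "N \<equiv> \<lambda>z. (cst a - 1) * eval_fps z gluing_tail2 + 2 * (cst a - 1) * (fps_X * z - 1)"
  assumes a: "a \<noteq> 1" and C: "\<And>z. axis_factor (cst a) fps_X z * eval_fps z C = axis_factor_norm (cst a) fps_X z * eval_fps z A"
    and eq: "\<And>z. z * (4 * eval_fps z C + (1 + (cst c - 1) * embed_series u') * M z + (1 + cst c * embed_series u') * N z) = 0"
  shows "algebraic_fps (embed_series u')"
proof -
  let ?a = "fps_const [:a:]" and ?c = "fps_const [:c:]" and ?u = "coef_fps u'"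
  define F where "F = 4 * C
    + (1 + (?c - 1) * ?u) * (4 * (?a - 1) - ?a * gluing_tail2 + 2 * ?a * (fps_X * xp - 1))
    + (1 + ?c * ?u) * ((?a - 1) * gluing_tail2 + 2 * (?a - 1) * (fps_X * xp - 1))"
  have F: "eval_fps z F = 4 * eval_fps z C + (1 + (cst c - 1) * embed_series u') * M z + (1 + cst c * embed_series u') * N z" for z
    unfolding F_def M_def N_def by (simp only: eval_simps)
  \<comment> \<open>The factor \<open>z\<close> is cancelled at \<open>xv\<close>, where it is
    nonzero; \<open>F = 0\<close> then holds also at a root equal to \<open>0\<close>.\<close>
  have "xv * eval_fps xv F = 0" unfolding F by (rule eq)
  hence "eval_fps xv F = 0" by (simp add: xv_def)
  hence "[:F $ n:] = 0" for n by (metis eval_fps_xv_nth fps_zero_nth)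
  hence "F = 0" by (intro fps_ext) simp
  hence F0: "eval_fps z F = 0" for z by (simp only: eval_simps)
  obtain z where z: "z $ 0 = 0" "axis_factor_norm (cst a) fps_X z = 0" "algebraic_fps z"
    using axis_factor_norm_root[OF a] by blast
  have "eval_fps z C = 0" using quotient_root[OF C z(2) a] .
  hence lin: "(1 + (cst c - 1) * embed_series u') * M z + (1 + cst c * embed_series u') * N z = 0"
    using F[of z] F0[of z] by simp
  have M: "M z = cst (4 * (a - 1)) - cst a * eval_fps z gluing_tail2 + cst (2 * a) * (fps_X * z - 1)"
    and N: "N z = cst (a - 1) * eval_fps z gluing_tail2 + cst (2 * (a - 1)) * (fps_X * z - 1)"
    by (simp_all add: M_def N_def cst_diff cst_mult)
  have two: "(2 :: complex poly poly) = [:[:2:]:]" by (simp add: numeral_poly)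
  show ?thesis
  proof (rule algebraic_from_linear[OF lin, of "4 * (a - 1)" "- 4 * (a - 1)"])
    show "algebraic_fps (M z)" "algebraic_fps (N z)"
      unfolding M_def N_def by (intro algebraic_intros algebraic_gluing_tail2 z)+
    show "M z $ 0 = [:[:4 * (a - 1):]:]" "N z $ 0 = [:[:- 4 * (a - 1):]:]"
      unfolding M N by (simp_all add: fps_mult_nth_0 eval_gluing_tail2_0 cst_nth_0 z two algebra_simps)
    \<comment> \<open>The terms in \<open>c\<close> cancel, so the equation is nondegenerate for
      every \<open>c\<close>.\<close>
    have "(c - 1) * (4 * (a - 1)) + c * (- 4 * (a - 1)) = - 4 * (a - 1)" by (simp add: algebra_simps)
    thus "(c - 1) * (4 * (a - 1)) + c * (- 4 * (a - 1)) \<noteq> 0" using a by simp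
  qed
qed

text \<open>When one weight is \<open>1\<close>, both decoupled equations lead to the same
  quotients, so \<open>algebraic_one_weight\<close> covers either case.\<close>

lemma coeff_differences:
  fixes t a T T0 T2 z :: "'a::comm_ring_1"
  assumes "2 * T - 2 * T0 = z * T2"
  shows "2 * (mu_coeff_x t a 1 T z - mu_coeff_x t a 1 T0 0) = z * t * (4 * (a - 1) - a * T2 + 2 * a * (t * z - 1))"
    and "2 * (nu_coeff_x t a 1 T z - nu_coeff_x t a 1 T0 0) = z * t * ((a - 1) * T2 + 2 * (a - 1) * (t * z - 1))"
    and "2 * (mu_coeff_y t 1 a T z - mu_coeff_y t 1 a T0 0) = z * t * (4 * (a - 1) - a * T2 + 2 * a * (t * z - 1))"
    and "2 * (nu_coeff_y t 1 a T z - nu_coeff_y t 1 a T0 0) = z * t * ((a - 1) * T2 + 2 * (a - 1) * (t * z - 1))"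
proof -
  have "2 * (mu_coeff_x t a 1 T z - mu_coeff_x t a 1 T0 0) = 4 * (a - 1) * t * z - t * a * (2 * T - 2 * T0) + 2 * t * a * (t * z\<^sup>2 - z)"
    by (simp add: mu_coeff_x_def algebra_simps)
  thus "2 * (mu_coeff_x t a 1 T z - mu_coeff_x t a 1 T0 0) = z * t * (4 * (a - 1) - a * T2 + 2 * a * (t * z - 1))"
    unfolding assms by (simp add: algebra_simps power2_eq_square)
  have "2 * (nu_coeff_x t a 1 T z - nu_coeff_x t a 1 T0 0) = t * (a - 1) * (2 * T - 2 * T0) + 2 * t * (a - 1) * (t * z\<^sup>2 - z)"
    by (simp add: nu_coeff_x_def algebra_simps)
  thus "2 * (nu_coeff_x t a 1 T z - nu_coeff_x t a 1 T0 0) = z * t * ((a - 1) * T2 + 2 * (a - 1) * (t * z - 1))"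
    unfolding assms by (simp add: algebra_simps power2_eq_square)
  have "2 * (mu_coeff_y t 1 a T z - mu_coeff_y t 1 a T0 0) = 4 * (a - 1) * t * z - t * a * (2 * T - 2 * T0) + 2 * t * a * (t * z\<^sup>2 - z)"
    by (simp add: mu_coeff_y_def algebra_simps)
  thus "2 * (mu_coeff_y t 1 a T z - mu_coeff_y t 1 a T0 0) = z * t * (4 * (a - 1) - a * T2 + 2 * a * (t * z - 1))"
    unfolding assms by (simp add: algebra_simps power2_eq_square)
  have "2 * (nu_coeff_y t 1 a T z - nu_coeff_y t 1 a T0 0) = t * (a - 1) * (2 * T - 2 * T0) + 2 * t * (a - 1) * (t * z\<^sup>2 - z)"
    by (simp add: nu_coeff_y_def algebra_simps)
  thus "2 * (nu_coeff_y t 1 a T z - nu_coeff_y t 1 a T0 0) = z * t * ((a - 1) * T2 + 2 * (a - 1) * (t * z - 1))"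
    unfolding assms by (simp add: algebra_simps power2_eq_square)
qed

lemma axis_factor_1: "axis_factor 1 t z = - (t * z)"
  by (simp add: axis_factor_def)

text \<open>The second hypothesis is the equation at \<open>0\<close>, where
  \<open>axis_factor 1\<close> vanishes. Subtracting it eliminates \<open>q\<close> and leaves a
  multiple of \<open>z t\<close>.\<close>

lemma one_weight_equation:
  fixes t z C q \<mu> \<nu> m n m0 n0 M N :: "'a::idom"
  assumes "2 * axis_factor 1 t z * C = q + \<mu> * m + \<nu> * n" "0 = q + \<mu> * m0 + \<nu> * n0"
    and "2 * (m - m0) = z * t * M" "2 * (n - n0) = z * t * N" "t \<noteq> 0"
  shows "z * (4 * C + \<mu> * M + \<nu> * N) = 0"
proof -
  have "t * (z * (4 * C + \<mu> * M + \<nu> * N)) = 4 * t * z * C + \<mu> * (z * t * M) + \<nu> * (z * t * N)"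
    by (simp add: algebra_simps)
  also have "\<dots> = 2 * ((q + \<mu> * m + \<nu> * n - 2 * axis_factor 1 t z * C) - (q + \<mu> * m0 + \<nu> * n0))"
    unfolding assms(3,4)[symmetric] axis_factor_1 by (simp add: algebra_simps)
  also have "\<dots> = 0" using assms(1,2) by simp
  finally show ?thesis using assms(5) by simp
qed

section \<open>Solving for the unknown series\<close>

lemma unknowns_algebraic:
  fixes a b c :: complex
  defines "t \<equiv> fps_X :: complex poly poly fps"
  assumes C: "\<And>z. axis_factor (cst a) t z * eval_fps z C = axis_factor_norm (cst a) t z * eval_fps z A"
    and C': "\<And>z. axis_factor (cst b) t z * eval_fps z C' = axis_factor_norm (cst b) t z * eval_fps z B"
    and X_eq: "\<And>z. 2 * axis_factor (cst b) t z * eval_fps z C = embed_series q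
      + (1 + (cst c - 1) * embed_series u) * mu_coeff_x t (cst a) (cst b) (eval_fps z gluing_tail) z
      + (1 + cst c * embed_series u) * nu_coeff_x t (cst a) (cst b) (eval_fps z gluing_tail) z"
    and Y_eq: "\<And>z. 2 * axis_factor (cst a) t z * eval_fps z C' = - embed_series q
      + (1 + (cst c - 1) * embed_series u) * mu_coeff_y t (cst a) (cst b) (eval_fps z gluing_tail) z
      + (1 + cst c * embed_series u) * nu_coeff_y t (cst a) (cst b) (eval_fps z gluing_tail) z"
  shows "algebraic_fps (embed_series u)" "algebraic_fps (embed_series q)"
proof -
  have T_diff: "2 * eval_fps z gluing_tail - 2 * eval_fps 0 gluing_tail = z * eval_fps z gluing_tail2" for z
    unfolding eval_gluing_tail_gluing_tail2 by simp
  note diffs = coeff_differences[OF T_diff]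
  show u: "algebraic_fps (embed_series u)"
  proof (cases "a = 1"; cases "b = 1")
    assume a: "a \<noteq> 1" and b: "b \<noteq> 1"
    obtain z where z: "z $ 0 = 0" "axis_factor_norm (cst a) t z = 0" "algebraic_fps z"
      unfolding t_def using axis_factor_norm_root[OF a] by blast
    obtain w where w: "w $ 0 = 0" "axis_factor_norm (cst b) t w = 0" "algebraic_fps w"
      unfolding t_def using axis_factor_norm_root[OF b] by blast
    have zC: "eval_fps z C = 0" using quotient_root[OF C[unfolded t_def] z(2)[unfolded t_def] a] .
    have wC: "eval_fps w C' = 0" using quotient_root[OF C'[unfolded t_def] w(2)[unfolded t_def] b] .
    \<comment> \<open>At the roots \<open>z\<close> and \<open>w\<close> the series \<open>C\<close>
      and \<open>C'\<close> vanish, and adding the two equations eliminates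
      \<open>q\<close>.\<close>
    let ?m = "mu_coeff_x t (cst a) (cst b) (eval_fps z gluing_tail) z + mu_coeff_y t (cst a) (cst b) (eval_fps w gluing_tail) w"
    let ?n = "nu_coeff_x t (cst a) (cst b) (eval_fps z gluing_tail) z + nu_coeff_y t (cst a) (cst b) (eval_fps w gluing_tail) w"
    have "(1 + (cst c - 1) * embed_series u) * ?m + (1 + cst c * embed_series u) * ?n =
      2 * axis_factor (cst b) t z * eval_fps z C + 2 * axis_factor (cst a) t w * eval_fps w C'"
      unfolding X_eq Y_eq by (simp add: algebra_simps)
    hence lin: "(1 + (cst c - 1) * embed_series u) * ?m + (1 + cst c * embed_series u) * ?n = 0"
      by (simp add: zC wC)
    show ?thesis
    proof (rule algebraic_from_linear[OF lin, of "- 2 * (a - 1) * (b - 1)" "2 * (a - 1) * (b - 1)"])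
      show "algebraic_fps ?m" "algebraic_fps ?n"
        unfolding t_def by (intro algebraic_fps_add algebraic_coeffs algebraic_gluing_tail z(3) w(3))+
      have k: "cst r - 1 = cst (r - 1)" for r by (simp add: cst_diff)
      have two: "(2 :: complex poly poly) = [:[:2:]:]" by (simp add: numeral_poly)
      show "?m $ 0 = [:[:- 2 * (a - 1) * (b - 1):]:]" "?n $ 0 = [:[:2 * (a - 1) * (b - 1):]:]"
        unfolding mu_coeff_x_def mu_coeff_y_def nu_coeff_x_def nu_coeff_y_def t_def k
        by (simp_all add: fps_mult_nth_0 cst_nth_0 z w two algebra_simps)
      have "(c - 1) * (- 2 * (a - 1) * (b - 1)) + c * (2 * (a - 1) * (b - 1)) = 2 * (a - 1) * (b - 1)"
        by (simp add: algebra_simps)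
      thus "(c - 1) * (- 2 * (a - 1) * (b - 1)) + c * (2 * (a - 1) * (b - 1)) \<noteq> 0" using a b by simp
    qed
  next
    assume a: "a \<noteq> 1" and b: "b = 1"
    show ?thesis
    proof (rule algebraic_one_weight[OF a C[unfolded t_def], where c = c])
      have X0: "0 = embed_series q + (1 + (cst c - 1) * embed_series u) * mu_coeff_x t (cst a) 1 (eval_fps 0 gluing_tail) 0
        + (1 + cst c * embed_series u) * nu_coeff_x t (cst a) 1 (eval_fps 0 gluing_tail) 0"
        using X_eq[of 0] by (simp add: b axis_factor_1)
      show "z * (4 * eval_fps z C
        + (1 + (cst c - 1) * embed_series u) * (4 * (cst a - 1) - cst a * eval_fps z gluing_tail2 + 2 * cst a * (fps_X * z - 1))
        + (1 + cst c * embed_series u) * ((cst a - 1) * eval_fps z gluing_tail2 + 2 * (cst a - 1) * (fps_X * z - 1))) = 0" for z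
        unfolding t_def[symmetric]
        by (rule one_weight_equation[OF X_eq[of z, unfolded b cst_1] X0 diffs(1) diffs(2)]) (simp add: t_def)
    qed
  next
    assume a: "a = 1" and b: "b \<noteq> 1"
    show ?thesis
    proof (rule algebraic_one_weight[OF b C'[unfolded t_def], where c = c])
      have Y0: "0 = - embed_series q + (1 + (cst c - 1) * embed_series u) * mu_coeff_y t 1 (cst b) (eval_fps 0 gluing_tail) 0
        + (1 + cst c * embed_series u) * nu_coeff_y t 1 (cst b) (eval_fps 0 gluing_tail) 0"
        using Y_eq[of 0] by (simp add: a axis_factor_1)
      show "z * (4 * eval_fps z C'
        + (1 + (cst c - 1) * embed_series u) * (4 * (cst b - 1) - cst b * eval_fps z gluing_tail2 + 2 * cst b * (fps_X * z - 1))
        + (1 + cst c * embed_series u) * ((cst b - 1) * eval_fps z gluing_tail2 + 2 * (cst b - 1) * (fps_X * z - 1))) = 0" for z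
        unfolding t_def[symmetric]
        by (rule one_weight_equation[OF Y_eq[of z, unfolded a cst_1] Y0 diffs(3) diffs(4)]) (simp add: t_def)
    qed
  next
    assume a: "a = 1" and b: "b = 1"
    let ?v = "embed_series gluing_param" and ?T = "eval_fps 0 gluing_tail"
    \<comment> \<open>At \<open>0\<close> both axis factors vanish. The sum of the two equations is
      free of \<open>q\<close> and is \<open>t^3\<close> times a linear equation for
      \<open>u\<close>, as \<open>gluing_tail\<close> at \<open>0\<close> is divisible by
      \<open>t^2\<close>.\<close>
    have T: "2 * ?T = t\<^sup>2 * (3 * ?v - ?v\<^sup>2)" unfolding t_def eval_gluing_tail_gluing_tail2 by simp
    have "t ^ 3 * ((1 + (cst c - 1) * embed_series u) * (?v\<^sup>2 - 3 * ?v) + (1 + cst c * embed_series u) * 2)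
      = - (t * (1 + (cst c - 1) * embed_series u) * (t\<^sup>2 * (3 * ?v - ?v\<^sup>2))) + (1 + cst c * embed_series u) * (2 * t ^ 3)"
      by (simp add: algebra_simps eval_nat_numeral)
    also have "\<dots> = (embed_series q + (1 + (cst c - 1) * embed_series u) * mu_coeff_x t 1 1 ?T 0 + (1 + cst c * embed_series u) * nu_coeff_x t 1 1 ?T 0)
      + (- embed_series q + (1 + (cst c - 1) * embed_series u) * mu_coeff_y t 1 1 ?T 0 + (1 + cst c * embed_series u) * nu_coeff_y t 1 1 ?T 0)"
      unfolding T[symmetric] mu_coeff_x_def nu_coeff_x_def mu_coeff_y_def nu_coeff_y_def by (simp add: algebra_simps)
    also have "\<dots> = 0" using X_eq[of 0] Y_eq[of 0] by (simp add: a b axis_factor_1)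
    finally have lin: "(1 + (cst c - 1) * embed_series u) * (?v\<^sup>2 - 3 * ?v) + (1 + cst c * embed_series u) * 2 = 0"
      by (simp add: t_def)
    have two: "(2 :: complex poly poly) = [:[:2:]:]" by (simp add: numeral_poly)
    show ?thesis
    proof (rule algebraic_from_linear[OF lin, of "- 2" 2])
      show "algebraic_fps (?v\<^sup>2 - 3 * ?v)" "algebraic_fps 2" by (intro algebraic_intros)+
      have "- 2 = ([:[:- 2:]:] :: complex poly poly)" unfolding two by simp
      moreover have "(?v\<^sup>2 - 3 * ?v) $ 0 = - 2"
        by (simp add: power2_eq_square fps_mult_nth_0 embed_series_gluing_param_0)
      ultimately show "(?v\<^sup>2 - 3 * ?v) $ 0 = [:[:- 2:]:]" by (rule trans[rotated])
      show "(2 :: complex poly poly fps) $ 0 = [:[:2:]:]"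
        using two by simp
      show "(c - 1) * - 2 + c * 2 \<noteq> 0" by (simp add: algebra_simps)
    qed
  qed
  show "algebraic_fps (embed_series q)"
  \<comment> \<open>Given \<open>u\<close>, one equation with vanishing left side yields
    \<open>q\<close>: at \<open>0\<close> if \<open>a = 1\<close>, otherwise at a root of the
    norm.\<close>
  proof (cases "a = 1")
    case True
    have "embed_series q = (1 + (cst c - 1) * embed_series u) * mu_coeff_y t (cst a) (cst b) (eval_fps 0 gluing_tail) 0
      + (1 + cst c * embed_series u) * nu_coeff_y t (cst a) (cst b) (eval_fps 0 gluing_tail) 0"
      using Y_eq[of 0] unfolding True cst_1 axis_factor_1 by (simp add: algebra_simps)
    thus ?thesis unfolding t_def
      by (simp only:) (intro algebraic_intros u algebraic_coeffs algebraic_gluing_tail)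
  next
    case False
    obtain z where z: "axis_factor_norm (cst a) t z = 0" "algebraic_fps z"
      unfolding t_def using axis_factor_norm_root[OF False] by blast
    have zC: "eval_fps z C = 0" using quotient_root[OF C[unfolded t_def] z(1)[unfolded t_def] False] .
    have "embed_series q = - ((1 + (cst c - 1) * embed_series u) * mu_coeff_x t (cst a) (cst b) (eval_fps z gluing_tail) z
      + (1 + cst c * embed_series u) * nu_coeff_x t (cst a) (cst b) (eval_fps z gluing_tail) z)"
      unfolding eq_neg_iff_add_eq_0 using X_eq[of z] unfolding zC by (simp add: add.assoc)
    thus ?thesis unfolding t_def
      by (simp only:) (intro algebraic_intros u algebraic_coeffs algebraic_gluing_tail z(2))
  qed
qed

lemma axis_factor_norm_nonzero: 
  assumes "z = xv \<or> z = yv"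
  shows "axis_factor_norm (cst a) fps_X z \<noteq> 0"
proof (cases "a = 1")
  case True
  thus ?thesis using assms by (auto simp: axis_factor_norm_def xv_def yv_def)
next
  case False
  have "axis_factor_norm (cst a) fps_X z = - (cst (a - 1))\<^sup>2 * z - (cst a - 1) * (cst a)\<^sup>2 * fps_X * invariant_num fps_X z
      - cst a ^ 3 * fps_X ^ 3 * z"
    by (simp add: axis_factor_norm_def cst_diff)
  hence "axis_factor_norm (cst a) fps_X z $ 0 = - ([:[:a - 1:]:] * [:[:a - 1:]:]) * z $ 0"
    by (simp only: fps_sub_nth fps_neg_nth fps_mult_nth_0 power2_eq_square cst_nth_0) simp
  moreover have "[:[:a - 1:]:] \<noteq> 0" "z $ 0 \<noteq> 0" using False assms by (auto simp: xv_def yv_def)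
  ultimately have "axis_factor_norm (cst a) fps_X z $ 0 \<noteq> 0" by (simp only: mult_eq_0_iff neg_equal_0_iff_equal) simp
  thus ?thesis by auto
qed

text \<open>Given \<open>u\<close> and \<open>q\<close>, the decoupled equations yield
  \<open>C\<close> and \<open>C'\<close>, these yield \<open>A\<close> and \<open>B\<close>, and the
  functional equation yields the walk series, each time by division by a nonzero algebraic
  series.\<close>

lemma algebraic_walk_gf: "algebraic_fps (walk_gf reverse_kreweras a b c)"
proof -
  let ?t = "fps_X :: complex poly poly fps"
  obtain A B C C' u q where FE: "rk_kernel ?t xv yv * walk_gf reverse_kreweras a b c =
      ((cst a - 1) * xv * yv - cst a * ?t) * (xv * eval_fps xv A)
      + ((cst b - 1) * xv * yv - cst b * ?t) * (yv * eval_fps yv B)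
      + xv * yv * (1 + (cst c - 1) * embed_series u) - ?t * (1 + cst c * embed_series u)"
    and C: "\<And>z. axis_factor (cst a) ?t z * eval_fps z C = axis_factor_norm (cst a) ?t z * eval_fps z A"
    and C': "\<And>z. axis_factor (cst b) ?t z * eval_fps z C' = axis_factor_norm (cst b) ?t z * eval_fps z B"
    and X_eq: "\<And>z. 2 * axis_factor (cst b) ?t z * eval_fps z C = embed_series q
      + (1 + (cst c - 1) * embed_series u) * mu_coeff_x ?t (cst a) (cst b) (eval_fps z gluing_tail) z
      + (1 + cst c * embed_series u) * nu_coeff_x ?t (cst a) (cst b) (eval_fps z gluing_tail) z"
    and Y_eq: "\<And>z. 2 * axis_factor (cst a) ?t z * eval_fps z C' = - embed_series q
      + (1 + (cst c - 1) * embed_series u) * mu_coeff_y ?t (cst a) (cst b) (eval_fps z gluing_tail) z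
      + (1 + cst c * embed_series u) * nu_coeff_y ?t (cst a) (cst b) (eval_fps z gluing_tail) z"
    using decoupled_equations[of a b c] by metis
  note uq = unknowns_algebraic[OF C C' X_eq Y_eq]
  have xy: "algebraic_fps xv" "algebraic_fps yv" "xv \<noteq> 0" "yv \<noteq> 0"
    by (auto simp: xv_def yv_def)
  have AC: "algebraic_fps (eval_fps xv C)"
    by (rule algebraic_fps_divide[OF X_eq])
      (use axis_factor_nonzero[of xv b] xy in simp, (intro algebraic_intros algebraic_axis_factor algebraic_coeffs algebraic_gluing_tail uq xy)+)
  have A: "algebraic_fps (eval_fps xv A)"
    by (rule algebraic_fps_divide[OF C[symmetric]])
      (simp add: axis_factor_norm_nonzero, (intro algebraic_intros algebraic_axis_factor algebraic_axis_factor_norm AC xy)+)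
  have AC': "algebraic_fps (eval_fps yv C')"
    by (rule algebraic_fps_divide[OF Y_eq])
      (use axis_factor_nonzero[of yv a] xy in simp, (intro algebraic_intros algebraic_axis_factor algebraic_coeffs algebraic_gluing_tail uq xy)+)
  have B: "algebraic_fps (eval_fps yv B)"
    by (rule algebraic_fps_divide[OF C'[symmetric]])
      (simp add: axis_factor_norm_nonzero, (intro algebraic_intros algebraic_axis_factor algebraic_axis_factor_norm AC' xy)+)
  have "rk_kernel ?t xv yv \<noteq> 0" using rk_kernel_nth_0 by auto
  moreover have "algebraic_fps (rk_kernel ?t xv yv)"
    unfolding rk_kernel_def by (intro algebraic_intros xy)
  ultimately show ?thesis
    by (rule algebraic_fps_divide[OF FE]) (intro algebraic_intros A B uq xy)
qed

theorem theorem2: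
  fixes a b c :: real
  shows "(ring.algebraic (ring_of_type_algebra :: complex poly poly fps fract ring)
           over rational_functions)
         (to_fract (walk_gf reverse_kreweras (of_real a) (of_real b) (of_real c)))"
  using algebraic_walk_gf[of "of_real a" "of_real b" "of_real c"]
  unfolding algebraic_fps_def algebraic_fract_def .

end
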